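(* For any $\alpha\in(0,2]$ and $\epsilon>0$, if $\varphi$ is an $\alpha$-bunched Anosov diffeomorphism of the torus $\mathbb{T}^2$, then the unstable (respectively, stable) foliation associated to $\varphi$ is $C^{\alpha-\epsilon}$ regular.
   Context: $\mathbb{T}^2$ is the torus obtained from $\{(x_1,x_2)\in\mathbb{R}^2:\max(|x_1|,|x_2|)\le 1\}$ by identifying opposite edges, with the metric $\|\cdot\|$ induced from $\mathbb{R}^2$. Anosov diffeomorphism: a volume preserving diffeomorphism $\varphi$ of $\mathbb{T}^2$ is Anosov with Anosov splitting $(E_u,E_s)$ if $T\mathbb{T}^2=E_u\oplus E_s$, where $E_u$ and $E_s$ are one-dimensional subbundles of $T\mathbb{T}^2$ such that $d\varphi(x)E_u(x)=E_u(\varphi(x))$ and $d\varphi(x)E_s(x)=E_s(\varphi(x))$ for all $x\in\mathbb{T}^2$, and there are constants $C>0$ and $0<\kappa<\lambda<1$ such that for all $x\in\mathbb{T}^2$, $u\in E_u(x)$, $v\in E_s(x)$ and integers $n\ge 0$, $$\tfrac1C\kappa^n\|u\|\le\|d\varphi^{-n}(x)u\|\le C\lambda^n\|u\|,\qquad \tfrac1C\kappa^n\|v\|\le\|d\varphi^{n}(x)v\|\le C\lambda^n\|v\|.$$ Bunching: for $\alpha\in(0,2]$, a point $x\in\mathbb{T}^2$ is called $\alpha$-bunched if there exist bunching constants $0<\kappa<\lambda<1$ that provide the bounds of the contraction rate in the inequalities displayed above and $\lambda^{2/\alpha}\le\kappa$. The diffeomorphism $\varphi$ is $\alpha$-bunched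 if $\sup_{x\in\mathbb{T}^2}\lambda^2\kappa^{-\alpha}<1$, where $\kappa,\lambda$ are the bunching constants at $x$. Foliations and regularity: the unstable (stable) manifold of a point $x$ is the immersed submanifold of points whose orbits remain close to the orbit of $x$ in the past (future); its tangent space at $x$ is $E_u(x)$ (respectively $E_s(x)$). The unstable (stable) manifolds form the unstable (stable) foliation. Its regularity is understood through how these tangent spaces vary with $x$, i.e. as the regularity of the map $x\mapsto E_u(x)$ (respectively $x\mapsto E_s(x)$). A distribution (subbundle of the tangent bundle) is $\beta$-Hölder if it is generated by vector fields whose coefficients in local coordinates are $\beta$-Hölder; a function $f$ is $\beta$-Hölder at a point $x_0$ if it is $\lfloor\beta\rfloor$ times differentiable and, for some $\delta>0$ and $K>0$, $|f^{(\lfloor\beta\rfloor)}(x_0)-f^{(\lfloor\beta\rfloor)}(x)|\le K|x_0-x|^{\beta-\lfloor\beta\rfloor}$ for all $|x_0-x|\le\delta$. Here $C^{\alpha-\epsilon}$ regularity is regularity in this sense with $\beta=\alpha-\epsilon$. *)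

theory Defs
  imports "HOL-Analysis.Analysis"
begin

section \<open>The torus\<close>

text \<open>The square \<open>max(|x1|,|x2|) \<le> 1\<close> has side length 2, so identifying its opposite edges gives
  the quotient of the plane by the lattice of vectors with even integer coordinates.\<close>

definition torus_rel :: "real^2 \<Rightarrow> real^2 \<Rightarrow> bool" where
  "torus_rel x y \<longleftrightarrow> (\<forall>i. \<exists>k::int. x $ i - y $ i = 2 * of_int k)"

lemma equivp_torus_rel: "equivp torus_rel"
proof (rule equivpI)
  show "reflp torus_rel"
    unfolding reflp_def torus_rel_def by (auto intro: exI[of _ "0::int"])
  show "symp torus_rel"
    unfolding symp_def torus_rel_def
  proof (intro allI impI)
    fix x y :: "real^2" and i
    assume "\<forall>i. \<exists>k::int. x $ i - y $ i = 2 * of_int k"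
    then obtain k :: int where "x $ i - y $ i = 2 * of_int k" by blast
    then show "\<exists>k::int. y $ i - x $ i = 2 * of_int k"
      by (intro exI[of _ "- k"]) simp
  qed
  show "transp torus_rel"
    unfolding transp_def torus_rel_def
  proof (intro allI impI)
    fix x y z :: "real^2" and i
    assume "\<forall>i. \<exists>k::int. x $ i - y $ i = 2 * of_int k"
      and "\<forall>i. \<exists>k::int. y $ i - z $ i = 2 * of_int k"
    then obtain k l :: int
      where "x $ i - y $ i = 2 * of_int k" "y $ i - z $ i = 2 * of_int l" by blast
    then show "\<exists>k::int. x $ i - z $ i = 2 * of_int k"
      by (intro exI[of _ "k + l"]) simp
  qed
qed

quotient_type torus = "real^2" / torus_rel
  morphisms rep_torus torus_of
  by (rule equivp_torus_rel)

lemma torus_of_eq_iff: "torus_of x = torus_of y \<longleftrightarrow> torus_rel x y"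
  by (rule torus.abs_eq_iff)

lemma torus_of_surj: "\<exists>x. torus_of x = p"
  by (rule exI[of _ "rep_torus p"]) (rule Quotient3_abs_rep[OF Quotient3_torus])

instantiation torus :: topological_space
begin

definition open_torus :: "torus set \<Rightarrow> bool" where
  "open_torus S \<longleftrightarrow> open (torus_of -` S)"

instance
  by standard (auto simp: open_torus_def vimage_Union)

end

text \<open>Lebesgue measure on the square, transported to the torus (the overlap of the edges is null).\<close>

definition torus_measure :: "torus measure" where
  "torus_measure = distr (restrict_space lborel (cbox (- 1) 1)) borel torus_of"

section \<open>Differentiability on the plane\<close>

text \<open>\<open>partials vs f\<close> is the iterated directional derivative of \<open>f\<close> along the vectors in \<open>vs\<close>.\<close>

primrec partials ::
  "'a list \<Rightarrow> ('a::euclidean_space \<Rightarrow> 'b::real_normed_vector) \<Rightarrow> 'a \<Rightarrow> 'b" where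
  "partials [] f = f"
| "partials (v # vs) f = (\<lambda>x. frechet_derivative (partials vs f) (at x) v)"

definition times_differentiable_on ::
  "nat \<Rightarrow> ('a::euclidean_space \<Rightarrow> 'b::real_normed_vector) \<Rightarrow> 'a set \<Rightarrow> bool" where
  "times_differentiable_on k f U \<longleftrightarrow>
     (\<forall>vs. set vs \<subseteq> Basis \<and> length vs < k \<longrightarrow> (\<forall>x\<in>U. partials vs f differentiable (at x)))"

definition smooth :: "('a::euclidean_space \<Rightarrow> 'b::real_normed_vector) \<Rightarrow> bool" where
  "smooth f \<longleftrightarrow> (\<forall>k. times_differentiable_on k f UNIV)"

text \<open>To be used with \<open>U\<close> open. The derivative of order \<open>\<lfloor>\<beta>\<rfloor>\<close> is given by its components, the
  partial derivatives of that order. The constants \<open>d\<close> and \<open>K\<close> may depend on the point \<open>a\<close>.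
  For \<open>\<beta> < 0\<close>, \<open>nat\<close> truncates the order to 0 and the exponent is \<open>\<beta>\<close> itself, so that
  the condition is then a mild one on the growth of \<open>f\<close>.\<close>

definition holder_on :: "real \<Rightarrow> ('a::euclidean_space \<Rightarrow> real) \<Rightarrow> 'a set \<Rightarrow> bool" where
  "holder_on \<beta> f U \<longleftrightarrow>
     times_differentiable_on (nat \<lfloor>\<beta>\<rfloor>) f U \<and>
     (\<forall>a\<in>U. \<exists>d>0. \<exists>K>0. \<forall>x\<in>U. norm (a - x) \<le> d \<longrightarrow>
        (\<forall>vs. set vs \<subseteq> Basis \<and> length vs = nat \<lfloor>\<beta>\<rfloor> \<longrightarrow>
           \<bar>partials vs f a - partials vs f x\<bar> \<le> K * norm (a - x) powr (\<beta> - real (nat \<lfloor>\<beta>\<rfloor>))))"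

section \<open>Diffeomorphisms of the torus\<close>

definition torus_lift :: "(torus \<Rightarrow> torus) \<Rightarrow> (real^2 \<Rightarrow> real^2) \<Rightarrow> bool" where
  "torus_lift \<phi> F \<longleftrightarrow> (\<forall>x. torus_of (F x) = \<phi> (torus_of x))"

definition torus_diffeo :: "(torus \<Rightarrow> torus) \<Rightarrow> bool" where
  "torus_diffeo \<phi> \<longleftrightarrow> bij \<phi> \<and> (\<exists>F. smooth F \<and> torus_lift \<phi> F) \<and> (\<exists>G. smooth G \<and> torus_lift (inv \<phi>) G)"

definition volume_preserving :: "(torus \<Rightarrow> torus) \<Rightarrow> bool" where
  "volume_preserving \<phi> \<longleftrightarrow> distr torus_measure torus_measure \<phi> = torus_measure"

text \<open>Every tangent space of the torus is identified with the plane, and the norm of tangent vectors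
  is the Euclidean one, by means of \<open>torus_of\<close>. The differential of \<open>\<phi>\<close> is that of any
  lift; lemma \<open>torus_deriv_eq\<close> below shows that it depends neither on the lift nor on the
  representative of the point.\<close>

definition torus_deriv :: "(torus \<Rightarrow> torus) \<Rightarrow> torus \<Rightarrow> real^2 \<Rightarrow> real^2" where
  "torus_deriv \<phi> p =
     (THE D. \<exists>F x. torus_lift \<phi> F \<and> torus_of x = p \<and> (F has_derivative D) (at x))"

lemma torus_lift_derivative_unique:
  assumes F: "torus_lift \<phi> F" "(F has_derivative D) (at x)"
    and G: "torus_lift \<phi> G" "(G has_derivative D') (at y)"
    and xy: "torus_of x = torus_of y"
  shows "D = D'"
proof -
  define m where "m = y - x"
  define h where "h = (\<lambda>z. F z - G (z + m))"
  have even_m: "\<exists>k::int. m $ i = 2 * of_int k" for i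
    using xy[symmetric] unfolding torus_of_eq_iff torus_rel_def m_def by simp
  have "torus_of (z + m) = torus_of z" for z
    unfolding torus_of_eq_iff torus_rel_def using even_m by simp
  then have "torus_of (F z) = torus_of (G (z + m))" for z
    using F(1) G(1) by (simp add: torus_lift_def)
  then have even_h: "\<exists>k::int. h z $ i = 2 * of_int k" for z i
    unfolding torus_of_eq_iff torus_rel_def h_def by simp
  have "((\<lambda>z. z + m) has_derivative (\<lambda>v. v)) (at x)"
    by (auto intro!: derivative_eq_intros)
  moreover have "(G has_derivative D') (at (x + m))"
    using G(2) by (simp add: m_def)
  ultimately have "((\<lambda>z. G (z + m)) has_derivative D') (at x)"
    using has_derivative_compose by fastforce
  then have h': "(h has_derivative (\<lambda>v. D v - D' v)) (at x)"
    unfolding h_def by (intro has_derivative_diff F(2))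
  then have "h \<midarrow>x\<rightarrow> h x"
    using has_derivative_continuous isCont_def by blast
  then have "\<forall>\<^sub>F z in at x. dist (h z) (h x) < 2"
    by (rule tendstoD) simp
  then have const: "\<forall>\<^sub>F z in at x. h z = h x"
  proof (rule eventually_mono)
    fix z assume z: "dist (h z) (h x) < 2"
    show "h z = h x"
    proof (rule vec_eq_iff[THEN iffD2], rule allI)
      fix i
      obtain k l :: int where kl: "h z $ i = 2 * of_int k" "h x $ i = 2 * of_int l"
        using even_h by blast
      have "\<bar>(h z - h x) $ i\<bar> < 2"
        using z component_le_norm_cart[of "h z - h x" i] by (simp add: dist_norm)
      then have "\<bar>real_of_int (k - l)\<bar> < 1"
        using kl by simp
      then have "k = l" by linarith
      then show "h z $ i = h x $ i" using kl by simp
    qed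
  qed
  have "((\<lambda>_. h x) has_derivative (\<lambda>v. D v - D' v)) (at x)"
    using has_derivative_transform_eventually[OF h' const] by simp
  then have "(\<lambda>v. D v - D' v) = (\<lambda>_. 0)"
    using has_derivative_unique has_derivative_const by blast
  then show ?thesis by (metis ext right_minus_eq)
qed

lemma torus_deriv_eq:
  assumes "torus_lift \<phi> F" "(F has_derivative D) (at x)"
  shows "torus_deriv \<phi> (torus_of x) = D"
  unfolding torus_deriv_def
  using assms by (blast intro: the_equality torus_lift_derivative_unique)

section \<open>Line fields on the torus\<close>

definition line_subbundle :: "(torus \<Rightarrow> (real^2) set) \<Rightarrow> bool" where
  "line_subbundle E \<longleftrightarrow>
     (\<forall>p. \<exists>U X. open U \<and> p \<in> torus_of ` U \<and> continuous_on U X \<and>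
        (\<forall>x\<in>U. X x \<noteq> 0 \<and> E (torus_of x) = span {X x}))"

text \<open>The local coordinates on the torus are the local inverses of \<open>torus_of\<close>. The regularity
  of the foliation tangent to \<open>E\<close> is by definition the regularity of \<open>E\<close>.\<close>

definition holder_line_field :: "real \<Rightarrow> (torus \<Rightarrow> (real^2) set) \<Rightarrow> bool" where
  "holder_line_field \<beta> E \<longleftrightarrow>
     (\<forall>p. \<exists>U X. open U \<and> p \<in> torus_of ` U \<and> (\<forall>i. holder_on \<beta> (\<lambda>x. X x $ i) U) \<and>
        (\<forall>x\<in>U. X x \<noteq> 0 \<and> E (torus_of x) = span {X x}))"

section \<open>Anosov diffeomorphisms and bunching\<close>

text \<open>The contraction rates \<open>\<kappa> < \<lambda>\<close> are called \<open>\<kappa>\<close> and \<open>\<mu>\<close>.\<close>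

definition contraction_bounds ::
  "(torus \<Rightarrow> torus) \<Rightarrow> (torus \<Rightarrow> (real^2) set) \<Rightarrow> (torus \<Rightarrow> (real^2) set) \<Rightarrow>
   real \<Rightarrow> real \<Rightarrow> real \<Rightarrow> torus \<Rightarrow> bool" where
  "contraction_bounds \<phi> Eu Es C \<kappa> \<mu> p \<longleftrightarrow>
     (\<forall>u\<in>Eu p. \<forall>v\<in>Es p. \<forall>n.
        1 / C * \<kappa> ^ n * norm u \<le> norm (torus_deriv (inv \<phi> ^^ n) p u) \<and>
        norm (torus_deriv (inv \<phi> ^^ n) p u) \<le> C * \<mu> ^ n * norm u \<and>
        1 / C * \<kappa> ^ n * norm v \<le> norm (torus_deriv (\<phi> ^^ n) p v) \<and>
        norm (torus_deriv (\<phi> ^^ n) p v) \<le> C * \<mu> ^ n * norm v)"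

definition anosov ::
  "(torus \<Rightarrow> torus) \<Rightarrow> (torus \<Rightarrow> (real^2) set) \<Rightarrow> (torus \<Rightarrow> (real^2) set) \<Rightarrow> bool" where
  "anosov \<phi> Eu Es \<longleftrightarrow>
     torus_diffeo \<phi> \<and> volume_preserving \<phi> \<and>
     line_subbundle Eu \<and> line_subbundle Es \<and>
     (\<forall>p. Eu p \<inter> Es p = {0} \<and> {u + v |u v. u \<in> Eu p \<and> v \<in> Es p} = UNIV) \<and>
     (\<forall>p. torus_deriv \<phi> p ` Eu p = Eu (\<phi> p) \<and> torus_deriv \<phi> p ` Es p = Es (\<phi> p)) \<and>
     (\<exists>C \<kappa> \<mu>. C > 0 \<and> 0 < \<kappa> \<and> \<kappa> < \<mu> \<and> \<mu> < 1 \<and> (\<forall>p. contraction_bounds \<phi> Eu Es C \<kappa> \<mu> p))"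

text \<open>In the bunching condition the rates depend on the point, and so may the constant \<open>C\<close>.\<close>

definition bunching_constants ::
  "real \<Rightarrow> (torus \<Rightarrow> torus) \<Rightarrow> (torus \<Rightarrow> (real^2) set) \<Rightarrow> (torus \<Rightarrow> (real^2) set) \<Rightarrow>
   torus \<Rightarrow> real \<Rightarrow> real \<Rightarrow> bool" where
  "bunching_constants \<alpha> \<phi> Eu Es p \<kappa> \<mu> \<longleftrightarrow>
     0 < \<kappa> \<and> \<kappa> < \<mu> \<and> \<mu> < 1 \<and> (\<exists>C>0. contraction_bounds \<phi> Eu Es C \<kappa> \<mu> p) \<and>
     \<mu> powr (2 / \<alpha>) \<le> \<kappa>"

text \<open>The set whose supremum is taken is bounded, since \<open>\<mu> powr (2 / \<alpha>) \<le> \<kappa>\<close> amounts to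
  \<open>\<mu>\<^sup>2 * \<kappa> powr - \<alpha> \<le> 1\<close>.\<close>

definition bunched ::
  "real \<Rightarrow> (torus \<Rightarrow> torus) \<Rightarrow> (torus \<Rightarrow> (real^2) set) \<Rightarrow> (torus \<Rightarrow> (real^2) set) \<Rightarrow> bool" where
  "bunched \<alpha> \<phi> Eu Es \<longleftrightarrow>
     (\<exists>\<kappa> \<mu>. (\<forall>p. bunching_constants \<alpha> \<phi> Eu Es p (\<kappa> p) (\<mu> p)) \<and>
        (SUP p. (\<mu> p)\<^sup>2 * \<kappa> p powr (- \<alpha>)) < 1)"

end

theory Submission
  imports Defs
begin

text \<open>Since \<open>\<phi>\<close> preserves area, it contracts the stable and expands the unstable direction by
  comparable factors, say \<open>1/c\<close> and \<open>c\<close>. So the action on slopes near the unstable direction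
  contracts by \<open>c\<^sup>2\<close>, whereas backward iteration expands distances by at most a constant times \<open>c\<close>,
  pointwise along each orbit. The difference of the unstable directions at \<open>x\<close> and \<open>y\<close> is therefore
  Lipschitz in \<open>y - x\<close>, and after its formal linearization \<open>A x (y - x)\<close> has been removed, it
  satisfies a recursion with a contraction factor \<open>1/c\<^sup>2\<close> that beats the factor
  \<open>c powr (1 + \<gamma>)\<close> of the distances for every \<open>\<gamma> < 1\<close>, once \<open>\<phi>\<close> has been replaced by a high
  iterate. This makes the unstable direction continuously differentiable with a \<open>\<gamma>\<close>-Hoelder derivative, for every
  \<open>\<gamma> < 1\<close>, which is enough because \<open>\<alpha> - \<epsilon> < 2\<close>. The stable direction is the unstable
  direction of the inverse.\<close>

section \<open>The wedge product of the plane\<close>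

text \<open>The expansion factor \<open>c\<close> varies from point to point, so gains and losses
  must be compared at the same point. Determinant 1 or -1 makes the inverse derivative as large as
  the derivative, and a uniform angle between the two directions bounds the latter by
  \<open>C\<^sub>0 * \<bar>c x\<bar>\<close>, with \<open>C\<^sub>0\<close> the same for all
  iterates. A backward step thus turns a distance \<open>D\<close> into at most
  \<open>2 * C\<^sub>0 * \<bar>c x\<bar> * D\<close>, and an error of size
  \<open>D powr (1 + \<gamma>)\<close> comes back with the factor \<open>(2 * C\<^sub>0) powr (1 +
  \<gamma>) * \<bar>c x\<bar> powr (\<gamma> - 1)\<close>. For \<open>\<gamma> < 1\<close> a long
  iterate makes this factor small; for \<open>\<gamma> = 1\<close> it would be a mere constant. The
  unit vectors that span the lines are picked point by point and may jump in sign, so nothing can be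
  differentiated at the outset. Slopes are compared instead, and \<open>A\<close> is constructed
  before slopes are known to have a derivative.\<close>

definition wedge :: "real^2 \<Rightarrow> real^2 \<Rightarrow> real" where
  "wedge v w = v $ 1 * w $ 2 - v $ 2 * w $ 1"

definition rot :: "real^2 \<Rightarrow> real^2" where
  "rot v = vector [- (v $ 2), v $ 1]"

lemma rot_nth [simp]: "rot v $ 1 = - (v $ 2)" "rot v $ 2 = v $ 1"
  by (simp_all add: rot_def)

lemma inner_vec2: "v \<bullet> w = v $ 1 * w $ 1 + v $ 2 * w $ 2" for v w :: "real^2"
  by (simp add: inner_vec_def sum_2)

lemma vec2_eq_iff: "v = w \<longleftrightarrow> v $ 1 = w $ 1 \<and> v $ 2 = w $ 2" for v w :: "real^2"
  by (simp add: vec_eq_iff forall_2)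

lemma wedge_lagrange: "(wedge v w)\<^sup>2 + (v \<bullet> w)\<^sup>2 = (norm v)\<^sup>2 * (norm w)\<^sup>2"
  unfolding power2_norm_eq_inner by (simp add: inner_vec2 wedge_def power2_eq_square algebra_simps)

lemma abs_wedge_le: "\<bar>wedge v w\<bar> \<le> norm v * norm w"
proof -
  have "(wedge v w)\<^sup>2 \<le> (norm v * norm w)\<^sup>2"
    using wedge_lagrange[of v w] zero_le_power2[of "v \<bullet> w"] unfolding power_mult_distrib by linarith
  then show ?thesis by (simp add: abs_le_square_iff[symmetric] del: power2_le_iff_abs_le)
qed

interpretation wedge: bounded_bilinear wedge
proof
  show "\<exists>K. \<forall>a b. norm (wedge a b) \<le> norm a * norm b * K"
    using abs_wedge_le by (intro exI[of _ 1]) simp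
qed (simp_all add: wedge_def algebra_simps)

lemma wedge_self [simp]: "wedge v v = 0"
  by (simp add: wedge_def)

lemma wedge_antisym: "wedge v w = - wedge w v"
  by (simp add: wedge_def)

lemma wedge_rot: "wedge v (rot v) = (norm v)\<^sup>2"
  by (simp add: wedge_def power2_norm_eq_inner inner_vec2)

lemma norm_rot [simp]: "norm (rot v) = norm v"
  by (simp add: norm_eq_sqrt_inner inner_vec2)

lemma inner_rot_self [simp]: "v \<bullet> rot v = 0"
  by (simp add: inner_vec2)

lemma unit_decomp:
  assumes "norm u = 1"
  shows "v = (u \<bullet> v) *\<^sub>R u + wedge u v *\<^sub>R rot u"
proof -
  have *: "u $ 1 * u $ 1 + u $ 2 * u $ 2 = 1"
    using assms by (simp add: norm_eq_sqrt_inner inner_vec2)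
  show ?thesis
    unfolding vec2_eq_iff inner_vec2 wedge_def using *
    by simp algebra
qed

section \<open>Uniform second order Taylor estimates\<close>

text \<open>The form in which smoothness enters the dynamical estimates: \<open>M\<close> and
  \<open>H\<close> play the roles of the first and second derivative, and one constant serves the
  whole space. No bound on \<open>f\<close> itself is included, because lifts of torus
  diffeomorphisms are unbounded.\<close>

definition taylor2 ::
  "('a::real_normed_vector \<Rightarrow> 'b::real_normed_vector) \<Rightarrow> ('a \<Rightarrow> 'a \<Rightarrow>\<^sub>L 'b) \<Rightarrow>
   ('a \<Rightarrow> 'a \<Rightarrow>\<^sub>L 'a \<Rightarrow>\<^sub>L 'b) \<Rightarrow> real \<Rightarrow> bool" where
  "taylor2 f M H K \<longleftrightarrow> 0 \<le> K \<and> (\<forall>x. norm (M x) \<le> K \<and> norm (H x) \<le> K) \<and>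
     (\<forall>x y. norm (f y - f x) \<le> K * norm (y - x) \<and>
        norm (M y - M x) \<le> K * norm (y - x) \<and>
        norm (f y - f x - M x (y - x)) \<le> K * (norm (y - x))\<^sup>2 \<and>
        norm (M y - M x - H x (y - x)) \<le> K * (norm (y - x))\<^sup>2)"

lemma taylor2D:
  assumes "taylor2 f M H K"
  shows "0 \<le> K" "norm (M x) \<le> K" "norm (H x) \<le> K"
    "norm (f y - f x) \<le> K * norm (y - x)"
    "norm (M y - M x) \<le> K * norm (y - x)"
    "norm (f y - f x - M x (y - x)) \<le> K * (norm (y - x))\<^sup>2"
    "norm (M y - M x - H x (y - x)) \<le> K * (norm (y - x))\<^sup>2"
  using assms by (auto simp: taylor2_def)

lemma taylor2_mono:
  assumes "taylor2 f M H K" "K \<le> L"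
  shows "taylor2 f M H L"
proof -
  have "K * norm (y - x) \<le> L * norm (y - x)" "K * (norm (y - x))\<^sup>2 \<le> L * (norm (y - x))\<^sup>2" for x y :: 'a
    using assms(2) by (auto intro: mult_right_mono)
  then show ?thesis
    using assms unfolding taylor2_def by (meson order_trans)
qed

lemma taylor2_has_derivative:
  assumes "taylor2 f M H K"
  shows "(f has_derivative M x) (at x)"
proof (rule has_derivativeI)
  show "bounded_linear (blinfun_apply (M x))" by (rule blinfun.bounded_linear_right)
  have "((\<lambda>y. K * norm (y - x)) \<longlongrightarrow> K * norm (x - x)) (at x)"
    by (intro tendsto_intros)
  then have lim: "((\<lambda>y. K * norm (y - x)) \<longlongrightarrow> 0) (at x)" by simp
  show "((\<lambda>y. (f y - f x - M x (y - x)) /\<^sub>R norm (y - x)) \<longlongrightarrow> 0) (at x)"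
  proof (rule Lim_null_comparison[OF _ lim], rule always_eventually, rule allI)
    fix y
    show "norm ((f y - f x - M x (y - x)) /\<^sub>R norm (y - x)) \<le> K * norm (y - x)"
    proof (cases "y = x")
      case False
      then show ?thesis
        using taylor2D(6)[OF assms, of y x]
        by (simp add: divide_inverse_commute[symmetric] pos_divide_le_eq power2_eq_square mult.assoc)
    qed simp
  qed
qed

lemma norm_blinfun_compose_mono:
  fixes A :: "'b::real_normed_vector \<Rightarrow>\<^sub>L 'c::real_normed_vector"
    and B :: "'a::real_normed_vector \<Rightarrow>\<^sub>L 'b"
  assumes "norm A \<le> p" "norm B \<le> q"
  shows "norm (A o\<^sub>L B) \<le> p * q"
  by (rule order_trans[OF norm_blinfun_compose])
     (intro mult_mono assms norm_ge_zero order_trans[OF norm_ge_zero assms(1)])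

lemma norm_blinfun_apply_mono:
  fixes A :: "'b::real_normed_vector \<Rightarrow>\<^sub>L 'c::real_normed_vector"
  assumes "norm A \<le> p" "norm v \<le> q"
  shows "norm (A v) \<le> p * q"
  by (rule order_trans[OF norm_blinfun])
     (intro mult_mono assms norm_ge_zero order_trans[OF norm_ge_zero assms(1)])

text \<open>Chain rule with uniform constants. The first derivative is explicit because iterates are
  tracked through it; of the second one only the existence is used later.\<close>

lemma taylor2_compose:
  assumes f: "taylor2 f M1 H1 K1" and g: "taylor2 g M2 H2 K2"
  shows "\<exists>H K. taylor2 (f \<circ> g) (\<lambda>x. M1 (g x) o\<^sub>L M2 x) H K"
proof -
  \<comment> \<open>Product rule for the composed first derivative, in the direction
    \<open>w\<close>.\<close>
  define H where "H x = Blinfun (\<lambda>w. (H1 (g x) (M2 x w) o\<^sub>L M2 x) + (M1 (g x) o\<^sub>L H2 x w))" for x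
  have bl: "bounded_linear (\<lambda>w. (H1 (g x) (M2 x w) o\<^sub>L M2 x) + (M1 (g x) o\<^sub>L H2 x w))" for x
    by (intro bounded_linear_add
          bounded_linear_compose[OF bounded_bilinear.bounded_linear_left[OF bounded_bilinear_blinfun_compose]]
          bounded_linear_compose[OF bounded_bilinear.bounded_linear_right[OF bounded_bilinear_blinfun_compose]]
          bounded_linear_compose[OF blinfun.bounded_linear_right] blinfun.bounded_linear_right)
  have H: "H x w = (H1 (g x) (M2 x w) o\<^sub>L M2 x) + (M1 (g x) o\<^sub>L H2 x w)" for x w
    by (simp add: H_def bounded_linear_Blinfun_apply[OF bl])
  define K where "K = K1*K2*K2 + K1*K2 + K1 * K2\<^sup>2 * K2 + K1*K2*K2 + K1*K2*K2"
  have pos: "0 \<le> K1" "0 \<le> K2" using taylor2D(1)[OF f] taylor2D(1)[OF g] by auto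
  have Hn: "norm (H x) \<le> K1*K2*K2 + K1*K2" for x
  proof (rule norm_blinfun_bound)
    fix w
    have "norm (H1 (g x) (M2 x w)) \<le> K1 * (K2 * norm w)"
      by (intro norm_blinfun_apply_mono taylor2D(2,3)[OF f] taylor2D(2,3)[OF g] order_refl)
    then have "norm (H1 (g x) (M2 x w) o\<^sub>L M2 x) \<le> K1 * (K2 * norm w) * K2"
      by (intro norm_blinfun_compose_mono taylor2D(2)[OF g])
    moreover have "norm (M1 (g x) o\<^sub>L H2 x w) \<le> K1 * (K2 * norm w)"
      by (intro norm_blinfun_compose_mono norm_blinfun_apply_mono taylor2D(2,3)[OF f] taylor2D(2,3)[OF g] order_refl)
    ultimately show "norm (H x w) \<le> (K1*K2*K2 + K1*K2) * norm w"
      unfolding H by (intro order_trans[OF norm_triangle_ineq]) (simp add: algebra_simps)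
  qed (use pos in auto)
  have "taylor2 (f \<circ> g) (\<lambda>x. M1 (g x) o\<^sub>L M2 x) H K"
    unfolding taylor2_def
  proof (intro conjI allI)
    show "0 \<le> K" using pos by (simp add: K_def)
    fix x
    have "norm (M1 (g x) o\<^sub>L M2 x) \<le> K1 * K2"
      by (intro norm_blinfun_compose_mono taylor2D(2)[OF f] taylor2D(2)[OF g])
    also have "\<dots> \<le> K" using pos by (simp add: K_def)
    finally show "norm (M1 (g x) o\<^sub>L M2 x) \<le> K" .
    show "norm (H x) \<le> K" 
    proof (rule order_trans[OF Hn])
      show "K1 * K2 * K2 + K1 * K2 \<le> K" using pos by (simp add: K_def)
    qed
    fix y
    define d where "d = norm (y - x)"
    have d: "0 \<le> d" by (simp add: d_def)
    have mK: "c * e \<le> K * e" if "c \<in> {K1*K2, K1*K2*K2 + K1*K2, K1*K2\<^sup>2*K2 + K1*K2*K2 + K1*K2*K2 + K1*K2, K1*K2\<^sup>2+K1*K2}" "0 \<le> e" for c e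
      using that(1) pos by (intro mult_right_mono[OF _ that(2)]) (auto simp: K_def power2_eq_square)
    have g1: "norm (g y - g x) \<le> K2 * d" using taylor2D(4)[OF g] by (simp add: d_def)
    have "norm ((f \<circ> g) y - (f \<circ> g) x) \<le> K1 * norm (g y - g x)"
      using taylor2D(4)[OF f] by simp
    also have "\<dots> \<le> K1 * (K2 * d)" by (intro mult_left_mono g1 pos)
    also have "\<dots> \<le> K * d" using mK[of "K1*K2" d] d by (simp add: mult.assoc)
    finally show "norm ((f \<circ> g) y - (f \<circ> g) x) \<le> K * norm (y - x)" by (simp add: d_def)
    have M1d: "norm (M1 (g y) - M1 (g x)) \<le> K1 * (K2 * d)"
      using taylor2D(5)[OF f, of "g y" "g x"] mult_left_mono[OF g1 pos(1)] by linarith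
    have M2d: "norm (M2 y - M2 x) \<le> K2 * d" using taylor2D(5)[OF g] by (simp add: d_def)
    have "(M1 (g y) o\<^sub>L M2 y) - (M1 (g x) o\<^sub>L M2 x)
        = ((M1 (g y) - M1 (g x)) o\<^sub>L M2 y) + (M1 (g x) o\<^sub>L (M2 y - M2 x))"
      by (rule blinfun_eqI) (simp add: blinfun.bilinear_simps)
    also have "norm \<dots> \<le> K1 * (K2 * d) * K2 + K1 * (K2 * d)"
      by (intro order_trans[OF norm_triangle_ineq] add_mono norm_blinfun_compose_mono M1d M2d taylor2D(2)[OF f] taylor2D(2)[OF g])
    also have "\<dots> = (K1*K2*K2 + K1*K2) * d" by (simp add: algebra_simps)
    also have "\<dots> \<le> K * d" using mK d by blast
    finally show "norm ((M1 (g y) o\<^sub>L M2 y) - (M1 (g x) o\<^sub>L M2 x)) \<le> K * norm (y - x)" by (simp add: d_def)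
    have g2: "norm (g y - g x - M2 x (y - x)) \<le> K2 * d\<^sup>2" using taylor2D(6)[OF g] by (simp add: d_def)
    have g1s: "K1 * (norm (g y - g x))\<^sup>2 \<le> K1 * (K2 * d)\<^sup>2"
      by (intro mult_left_mono power_mono g1 pos) simp
    have "(f \<circ> g) y - (f \<circ> g) x - (M1 (g x) o\<^sub>L M2 x) (y - x)
       = (f (g y) - f (g x) - M1 (g x) (g y - g x)) + M1 (g x) (g y - g x - M2 x (y - x))"
      by (simp add: blinfun.bilinear_simps)
    also have "norm \<dots> \<le> K1 * (K2 * d)\<^sup>2 + K1 * (K2 * d\<^sup>2)"
      by (intro order_trans[OF norm_triangle_ineq] add_mono norm_blinfun_apply_mono g2 taylor2D(2)[OF f]
           order_trans[OF taylor2D(6)[OF f] g1s])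
    also have "\<dots> = (K1*K2\<^sup>2+K1*K2) * d\<^sup>2" by (simp add: algebra_simps power_mult_distrib)
    also have "\<dots> \<le> K * d\<^sup>2" using mK by simp
    finally show "norm ((f \<circ> g) y - (f \<circ> g) x - (M1 (g x) o\<^sub>L M2 x) (y - x)) \<le> K * (norm (y - x))\<^sup>2"
      by (simp add: d_def)
    have a1: "norm (M1 (g y) - M1 (g x) - H1 (g x) (g y - g x)) \<le> K1 * (K2 * d)\<^sup>2"
      by (rule order_trans[OF taylor2D(7)[OF f] g1s])
    have a2: "norm (H1 (g x) (g y - g x - M2 x (y - x))) \<le> K1 * (K2 * d\<^sup>2)"
      by (intro norm_blinfun_apply_mono g2 taylor2D(3)[OF f])
    have a3: "norm (H1 (g x) (M2 x (y - x))) \<le> K1 * (K2 * d)"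
      by (intro norm_blinfun_apply_mono taylor2D(3)[OF f] taylor2D(2)[OF g]) (simp add: d_def)
    have a4: "norm (M2 y - M2 x - H2 x (y - x)) \<le> K2 * d\<^sup>2" using taylor2D(7)[OF g] by (simp add: d_def)
    have "(M1 (g y) o\<^sub>L M2 y) - (M1 (g x) o\<^sub>L M2 x) - H x (y - x)
      = ((M1 (g y) - M1 (g x) - H1 (g x) (g y - g x)) o\<^sub>L M2 y)
       + (H1 (g x) (g y - g x - M2 x (y - x)) o\<^sub>L M2 y)
       + (H1 (g x) (M2 x (y - x)) o\<^sub>L (M2 y - M2 x))
       + (M1 (g x) o\<^sub>L (M2 y - M2 x - H2 x (y - x)))"
      unfolding H by (rule blinfun_eqI) (simp add: blinfun.bilinear_simps)
    also have "norm \<dots> \<le> K1 * (K2 * d)\<^sup>2 * K2 + K1 * (K2 * d\<^sup>2) * K2 + K1 * (K2 * d) * (K2 * d) + K1 * (K2 * d\<^sup>2)"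
      by (intro order_trans[OF norm_triangle_ineq] add_mono norm_blinfun_compose_mono a1 a2 a3 a4 M2d taylor2D(2)[OF f] taylor2D(2)[OF g])
    also have "\<dots> = (K1*K2\<^sup>2*K2 + K1*K2*K2 + K1*K2*K2 + K1*K2) * d\<^sup>2"
      by (simp add: algebra_simps power_mult_distrib power2_eq_square)
    also have "\<dots> \<le> K * d\<^sup>2" using mK by simp
    finally show "norm ((M1 (g y) o\<^sub>L M2 y) - (M1 (g x) o\<^sub>L M2 x) - H x (y - x)) \<le> K * (norm (y - x))\<^sup>2"
      by (simp add: d_def)
  qed
  then show ?thesis by blast
qed

section \<open>First order expansion of an expanding line field\<close>

lemma le_of_le_add_half_powers:
  fixes a b B :: real
  assumes "\<And>n::nat. a \<le> b + (1/2)^n * B"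
  shows "a \<le> b"
proof (rule LIMSEQ_le_const[OF _ exI[of _ 0]])
  have "(\<lambda>n. b + (1/2)^n * B) \<longlonglongrightarrow> b + 0 * B"
    by (intro tendsto_intros LIMSEQ_power_zero) simp
  then show "(\<lambda>n. b + (1/2)^n * B) \<longlonglongrightarrow> b" by simp
qed (use assms in simp)

text \<open>Picard iteration from the zero section: consecutive iterates differ by at most
  \<open>(1/2)^n * B\<close> at every point, so they converge pointwise and the limit is at most
  \<open>2 * B\<close>. No topology on the base is involved.\<close>

lemma bounded_fibre_contraction_fixpoint:
  fixes L :: "'a \<Rightarrow> 'b::banach \<Rightarrow> 'b" and g :: "'a \<Rightarrow> 'a"
  assumes lip: "\<And>x v w. norm (L x v - L x w) \<le> norm (v - w) / 2"
    and bnd: "\<And>x. norm (L x 0) \<le> B"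
  shows "\<exists>A. \<forall>x. A x = L x (A (g x)) \<and> norm (A x) \<le> 2 * B"
proof -
  define a where "a n = ((\<lambda>A x. L x (A (g x))) ^^ n) (\<lambda>_. 0)" for n :: nat
  have a0: "a 0 x = 0" and aS: "a (Suc n) x = L x (a n (g x))" for n x
    by (simp_all add: a_def)
  have diff: "norm (a (Suc n) x - a n x) \<le> (1/2)^n * B" for n x
  proof (induction n arbitrary: x)
    case 0
    then show ?case using bnd by (simp add: aS a0)
  next
    case (Suc n)
    show ?case
      using lip[of x "a (Suc n) (g x)" "a n (g x)"] Suc[of "g x"] by (simp only: aS) simp
  qed
  have a_bound: "norm (a n x) \<le> 2 * B" for n x
  proof (induction n arbitrary: x)
    case 0
    then show ?case using order_trans[OF norm_ge_zero bnd] by (simp add: a0)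
  next
    case (Suc n)
    have "norm (a (Suc n) x) \<le> norm (L x (a n (g x)) - L x 0) + norm (L x 0)"
      unfolding aS using norm_triangle_sub[of "L x (a n (g x))" "L x 0"] by simp
    also have "\<dots> \<le> norm (a n (g x)) / 2 + B"
      using lip[of x "a n (g x)" 0] bnd[of x] by simp
    finally show ?case using Suc[of "g x"] by simp
  qed
  have conv: "convergent (\<lambda>n. a n x)" for x
  proof -
    have "summable (\<lambda>n. a (Suc n) x - a n x)"
      by (rule summable_comparison_test'[of "\<lambda>n. (1/2)^n * B" 0])
         (use diff in \<open>auto intro!: summable_mult2 summable_geometric\<close>)
    then have "convergent (\<lambda>n. \<Sum>k<n. a (Suc k) x - a k x)"
      by (simp add: summable_iff_convergent)
    then show ?thesis by (simp add: sum_lessThan_telescope[of "\<lambda>k. a k x"] a0 del: sum_subtractf)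
  qed
  define A where "A x = lim (\<lambda>n. a n x)" for x
  have lim: "(\<lambda>n. a n x) \<longlonglongrightarrow> A x" for x
    using conv[of x] by (simp add: A_def convergent_LIMSEQ_iff)
  have "A x = L x (A (g x))" for x
  proof (rule LIMSEQ_unique[OF LIMSEQ_Suc[OF lim]])
    have "(\<lambda>n. L x (a n (g x)) - L x (A (g x))) \<longlonglongrightarrow> 0"
    proof (rule Lim_null_comparison[OF always_eventually])
      show "\<forall>n. norm (L x (a n (g x)) - L x (A (g x))) \<le> norm (a n (g x) - A (g x)) / 2"
        using lip by blast
      have "(\<lambda>n. norm (a n (g x) - A (g x)) / 2) \<longlonglongrightarrow> norm (A (g x) - A (g x)) / 2"
        by (intro tendsto_intros lim) simp
      then show "(\<lambda>n. norm (a n (g x) - A (g x)) / 2) \<longlonglongrightarrow> 0" by simp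
    qed
    then show "(\<lambda>n. a (Suc n) x) \<longlonglongrightarrow> L x (A (g x))"
      unfolding aS by (simp add: LIM_zero_cancel)
  qed
  moreover have "norm (A x) \<le> 2 * B" for x
    by (rule LIMSEQ_le_const2[OF tendsto_norm[OF lim] exI[of _ 0]]) (use a_bound in simp)
  ultimately show ?thesis by blast
qed

text \<open>This depends only on the lines spanned by \<open>v\<close> and \<open>w\<close>, so that line fields need no
  orientation. It is \<open>0\<close> for orthogonal vectors.\<close>

definition tan_angle :: "real^2 \<Rightarrow> real^2 \<Rightarrow> real" where
  "tan_angle v w = wedge v w / (v \<bullet> w)"

lemma tan_angle_scaleR:
  assumes "a \<noteq> 0" "b \<noteq> 0"
  shows "tan_angle (a *\<^sub>R v) (b *\<^sub>R w) = tan_angle v w"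
  using assms by (simp add: tan_angle_def wedge.scaleR_left wedge.scaleR_right)

text \<open>\<open>tan_angle u v\<close> is the slope of the line of \<open>v\<close> in the
  orthonormal frame \<open>u\<close>, \<open>rot u\<close>, hence a coordinate for the lines not
  orthogonal to \<open>u\<close>.\<close>

lemma tan_angle_decomp:
  assumes "norm u = 1" "u \<bullet> v \<noteq> 0"
  shows "v = (u \<bullet> v) *\<^sub>R (u + tan_angle u v *\<^sub>R rot u)"
  using unit_decomp[OF assms(1), of v] assms(2) by (simp add: tan_angle_def scaleR_add_right)

text \<open>\<open>F\<close> will be a high iterate of a lift. The signs of the unit vectors
  \<open>u\<close> are arbitrary, so only the absolute value of \<open>c\<close> is constrained.
  \<open>norm_MG\<close> bounds the inverse derivative by \<open>c\<close> at the preimage, which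
  keeps the estimates pointwise. The first part of \<open>gap\<close> serves the Lipschitz bound and
  the equation for \<open>A\<close>, the second the exponent \<open>1 + \<gamma>\<close>.\<close>

locale expanding_line_field =
  fixes F G :: "real^2 \<Rightarrow> real^2" and M MG H HG and K C\<^sub>0 \<gamma> :: real
    and u :: "real^2 \<Rightarrow> real^2" and c \<sigma> :: "real^2 \<Rightarrow> real"
  assumes F_taylor: "taylor2 F M H K" and G_taylor: "taylor2 G MG HG K"
    and F_G: "F (G x) = x"
    and unit: "norm (u x) = 1"
    and invariant: "M x (u x) = c x *\<^sub>R u (F x)"
    and wedge_M: "wedge (M x v) (M x w) = \<sigma> x * wedge v w"
    and abs_\<sigma>: "\<bar>\<sigma> x\<bar> = 1"
    and norm_MG: "norm (MG x) \<le> C\<^sub>0 * \<bar>c (G x)\<bar>"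
    and K: "1 \<le> K" and C\<^sub>0: "1 \<le> C\<^sub>0" and \<gamma>: "0 \<le> \<gamma>" "\<gamma> < 1"
    and gap: "4 * C\<^sub>0 \<le> \<bar>c x\<bar>" "8 * C\<^sub>0\<^sup>2 \<le> \<bar>c x\<bar> powr (1 - \<gamma>)"
begin

abbreviation t :: "real^2 \<Rightarrow> real^2 \<Rightarrow> real" where "t x y \<equiv> tan_angle (u x) (u y)"

section \<open>Lipschitz dependence of the lines on the base point\<close>

lemma c_ge: "4 \<le> \<bar>c x\<bar>" using gap(1)[of x] C\<^sub>0 by linarith

lemma c2_ge: "4 \<le> (c x)\<^sup>2"
proof -
  have "4\<^sup>2 \<le> (\<bar>c x\<bar>)\<^sup>2" by (intro power_mono c_ge) simp
  then show ?thesis by simp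
qed

text \<open>Within radius \<open>1 / K\<close> the quadratic Taylor error is at most the distance
  itself, which the linear bound majorizes because \<open>C\<^sub>0\<close> and
  \<open>\<bar>c (G X)\<bar>\<close> are at least 1. Hence the factor 2.\<close>

lemma G_expansion:
  assumes "norm (Y - X) \<le> 1 / K"
  shows "norm (G Y - G X) \<le> 2 * C\<^sub>0 * \<bar>c (G X)\<bar> * norm (Y - X)"
proof -
  have "norm (G Y - G X) \<le> norm (G Y - G X - MG X (Y - X)) + norm (MG X (Y - X))"
    by (metis diff_add_cancel norm_triangle_ineq)
  also have "\<dots> \<le> K * (norm (Y - X))\<^sup>2 + C\<^sub>0 * \<bar>c (G X)\<bar> * norm (Y - X)"
    by (intro add_mono taylor2D(6)[OF G_taylor] norm_blinfun_apply_mono norm_MG order_refl)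
  also have "K * (norm (Y - X))\<^sup>2 \<le> 1 * norm (Y - X)"
    unfolding power2_eq_square mult.assoc[symmetric]
    using assms K by (intro mult_right_mono) (simp_all add: field_simps)
  also have "1 * norm (Y - X) \<le> C\<^sub>0 * \<bar>c (G X)\<bar> * norm (Y - X)"
    using mult_mono[of 1 C\<^sub>0 1 "\<bar>c (G X)\<bar>"] C\<^sub>0 c_ge[of "G X"] by (intro mult_right_mono) auto
  finally show ?thesis by simp
qed

text \<open>\<open>M x\<close> preserves the wedge up to sign; replacing \<open>M y\<close> by
  \<open>M x\<close> on the second vector costs the Lipschitz term.\<close>

lemma wedge_step:
  "\<bar>c x\<bar> * \<bar>c y\<bar> * \<bar>wedge (u (F x)) (u (F y))\<bar> \<le> \<bar>wedge (u x) (u y)\<bar> + K\<^sup>2 * norm (y - x)"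
proof -
  have "c x * c y * wedge (u (F x)) (u (F y)) = wedge (M x (u x)) (M y (u y))"
    by (simp add: invariant wedge.scaleR_left wedge.scaleR_right)
  also have "\<dots> = \<sigma> x * wedge (u x) (u y) + wedge (M x (u x)) ((M y - M x) (u y))"
    by (simp add: wedge_M[symmetric] blinfun.diff_left wedge.diff_right)
  finally have "\<bar>c x\<bar> * \<bar>c y\<bar> * \<bar>wedge (u (F x)) (u (F y))\<bar>
      = \<bar>\<sigma> x * wedge (u x) (u y) + wedge (M x (u x)) ((M y - M x) (u y))\<bar>"
    by (simp add: abs_mult[symmetric])
  also have "\<dots> \<le> \<bar>\<sigma> x * wedge (u x) (u y)\<bar> + \<bar>wedge (M x (u x)) ((M y - M x) (u y))\<bar>"
    by (rule abs_triangle_ineq)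
  also have "\<bar>wedge (M x (u x)) ((M y - M x) (u y))\<bar> \<le> (K * 1) * (K * norm (y - x) * 1)"
    using K by (intro order_trans[OF abs_wedge_le] mult_mono norm_blinfun_apply_mono
        taylor2D(2,5)[OF F_taylor]) (auto simp: unit)
  finally show ?thesis by (simp add: abs_mult abs_\<sigma> power2_eq_square)
qed

text \<open>The error term \<open>(1/2)^n\<close> stands in for an a priori modulus of continuity of \<open>u\<close>: each
  backward step halves it, and continuity is never used.\<close>

lemma wedge_lipschitz: "\<bar>wedge (u X) (u Y)\<bar> \<le> K\<^sup>2 * norm (Y - X)"
proof (rule le_of_le_add_half_powers[where B = 1])
  have K2: "1 \<le> K\<^sup>2" "K \<le> K\<^sup>2" using K by (auto simp: self_le_power one_le_power)
  fix n
  show "\<bar>wedge (u X) (u Y)\<bar> \<le> K\<^sup>2 * norm (Y - X) + (1/2)^n * 1"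
  proof (induction n arbitrary: X Y)
    case 0
    have "\<bar>wedge (u X) (u Y)\<bar> \<le> 1" using abs_wedge_le[of "u X" "u Y"] by (simp add: unit)
    then show ?case using K2 by (simp add: add_increasing)
  next
    case (Suc n)
    show ?case
    proof (cases "norm (Y - X) \<le> 1 / K")
      case False
      then have "1 \<le> K * norm (Y - X)" using K by (simp add: field_simps)
      also have "\<dots> \<le> K\<^sup>2 * norm (Y - X)" using K2 by (intro mult_right_mono) auto
      finally show ?thesis
        using abs_wedge_le[of "u X" "u Y"] zero_le_power[of "1/2::real" "Suc n"] unfolding unit by linarith
    next
      case True
      define x y where "x = G X" and "y = G Y"
      define D where "D = norm (Y - X)"
      define w where "w = \<bar>wedge (u X) (u Y)\<bar>"
      have cp: "4 \<le> \<bar>c x\<bar>" "4 \<le> \<bar>c y\<bar>" "4 * C\<^sub>0 \<le> \<bar>c y\<bar>" using c_ge gap by auto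
      have "\<bar>c x\<bar> * \<bar>c y\<bar> * w \<le> \<bar>wedge (u x) (u y)\<bar> + K\<^sup>2 * norm (y - x)"
        using wedge_step[of x y] by (simp add: x_def y_def F_G w_def)
      also have "\<dots> \<le> 2 * K\<^sup>2 * norm (y - x) + (1/2)^n"
        using Suc.IH[of x y] by (simp add: mult.commute)
      \<comment> \<open>The preimages are farther apart, but the division by
        \<open>\<bar>c x\<bar> * \<bar>c y\<bar>\<close> wins:
        \<open>4 * C\<^sub>0 \<le> \<bar>c y\<bar>\<close> restores exactly the constant
        \<open>K\<^sup>2\<close>.\<close>
      also have "\<dots> \<le> 2 * K\<^sup>2 * (2 * C\<^sub>0 * \<bar>c x\<bar> * D) + (1/2)^n"
        using G_expansion[OF True] K2 by (intro add_right_mono mult_left_mono) (auto simp: x_def y_def D_def)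
      also have "\<dots> = K\<^sup>2 * D * \<bar>c x\<bar> * (4 * C\<^sub>0) + (1/2)^n" by simp
      also have "\<dots> \<le> K\<^sup>2 * D * \<bar>c x\<bar> * \<bar>c y\<bar> + \<bar>c x\<bar> * \<bar>c y\<bar> * (1/2)^Suc n"
      proof (intro add_mono mult_left_mono)
        have "2 * (1/2)^Suc n \<le> (\<bar>c x\<bar> * \<bar>c y\<bar>) * (1/2::real)^Suc n"
          using mult_mono[of 2 "\<bar>c x\<bar>" 1 "\<bar>c y\<bar>"] cp by (intro mult_right_mono) auto
        then show "(1/2::real)^n \<le> (\<bar>c x\<bar> * \<bar>c y\<bar>) * (1/2)^Suc n" by simp
      qed (use cp K2 in \<open>auto simp: D_def\<close>)
      finally have "\<bar>c x\<bar> * \<bar>c y\<bar> * w \<le> \<bar>c x\<bar> * \<bar>c y\<bar> * (K\<^sup>2 * D + (1/2)^Suc n)"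
        by (simp add: algebra_simps)
      moreover have "0 < \<bar>c x\<bar> * \<bar>c y\<bar>" using cp by (intro mult_pos_pos) auto
      ultimately have "w \<le> K\<^sup>2 * D + (1/2)^Suc n" by (rule mult_left_le_imp_le)
      then show ?thesis by (simp add: w_def D_def)
    qed
  qed
qed

text \<open>Below this radius the wedge is at most \<open>1/2\<close>, so by Lagrange's identity the
  lines are far from orthogonal and the division by their inner product is harmless.\<close>

lemma close_lines:
  assumes "norm (y - x) \<le> 1 / (2 * K\<^sup>2)"
  shows "1/2 \<le> \<bar>u x \<bullet> u y\<bar>" "\<bar>t x y\<bar> \<le> 2 * K\<^sup>2 * norm (y - x)" "\<bar>t x y\<bar> \<le> 1"
proof -
  have K2: "0 < K\<^sup>2" using K by simp
  have "K\<^sup>2 * norm (y - x) \<le> 1/2" using assms K2 by (simp add: field_simps)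
  then have "\<bar>wedge (u x) (u y)\<bar> \<le> 1/2" using wedge_lipschitz[of x y] by linarith
  then have "(wedge (u x) (u y))\<^sup>2 \<le> (1/2)\<^sup>2" by (simp add: abs_le_square_iff[symmetric] del: power_divide)
  then have "(1/2)\<^sup>2 \<le> (u x \<bullet> u y)\<^sup>2"
    using wedge_lagrange[of "u x" "u y"] by (simp add: unit power_divide)
  then show i: "1/2 \<le> \<bar>u x \<bullet> u y\<bar>" by (simp add: abs_le_square_iff[symmetric] del: power_divide)
  have "\<bar>t x y\<bar> = \<bar>wedge (u x) (u y)\<bar> / \<bar>u x \<bullet> u y\<bar>" by (simp add: tan_angle_def)
  also have "\<dots> \<le> \<bar>wedge (u x) (u y)\<bar> / (1/2)"
    using i by (intro divide_left_mono) auto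
  finally show *: "\<bar>t x y\<bar> \<le> 2 * K\<^sup>2 * norm (y - x)" using wedge_lipschitz[of x y] by simp
  then show "\<bar>t x y\<bar> \<le> 1" using \<open>K\<^sup>2 * norm (y - x) \<le> 1/2\<close> by linarith
qed

text \<open>Divided by \<open>(c x)\<^sup>2\<close>, this is the first order change of the image
  slope when the base point moves by \<open>v\<close> and the vector \<open>u x\<close> is
  kept.\<close>

definition \<beta> :: "real^2 \<Rightarrow> ((real^2) \<Rightarrow>\<^sub>L real)" where
  "\<beta> x = Blinfun (\<lambda>v. wedge (M x (u x)) (H x v (u x)))"

lemma \<beta>: "\<beta> x v = wedge (M x (u x)) (H x v (u x))"
proof -
  have "bounded_linear (\<lambda>v. wedge (M x (u x)) (H x v (u x)))"
    by (intro bounded_linear_compose[OF wedge.bounded_linear_right]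
        bounded_linear_compose[OF blinfun.bounded_linear_left] blinfun.bounded_linear_right)
  then show ?thesis by (simp add: \<beta>_def bounded_linear_Blinfun_apply)
qed

lemma norm_M_u: "norm (M x (u x)) \<le> K"
  using norm_blinfun_apply_mono[OF taylor2D(2)[OF F_taylor], of "u x" 1 x] by (simp add: unit)

lemma norm_\<beta>: "norm (\<beta> x) \<le> K\<^sup>2"
proof (rule norm_blinfun_bound)
  fix v
  have "\<bar>wedge (M x (u x)) (H x v (u x))\<bar> \<le> K * (K * norm v * 1)"
    using K by (intro order_trans[OF abs_wedge_le] mult_mono norm_M_u norm_blinfun_apply_mono
        taylor2D(3)[OF F_taylor]) (auto simp: unit)
  then show "norm (\<beta> x v) \<le> K\<^sup>2 * norm v" by (simp add: \<beta> power2_eq_square)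
qed simp

text \<open>The line at \<open>y\<close> is spanned by
  \<open>u x + \<tau> *\<^sub>R rot (u x)\<close>, where \<open>\<tau>\<close> is its slope over
  \<open>u x\<close>. The slope of its image \<open>q\<close> under \<open>M y\<close> over
  \<open>p = M x (u x)\<close> is \<open>wedge p q / (p \<bullet> q)\<close>; to first order the
  numerator is \<open>\<sigma> x * \<tau> + \<beta> x (y - x)\<close> and the denominator is
  \<open>(c x)\<^sup>2\<close>. Within the radius \<open>\<delta>\<close> the denominator moves by
  at most 1, so it stays away from 0.\<close>

lemma tan_angle_step:
  defines "\<delta> \<equiv> 1 / (K\<^sup>2 + 2 * K^4)"
  assumes d: "norm (y - x) \<le> \<delta>"
  shows "\<bar>t (F x) (F y) - (\<sigma> x * t x y + \<beta> x (y - x)) / (c x)\<^sup>2\<bar>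
    \<le> (K\<^sup>2 + 2 * K^4 + 4 * K\<^sup>2 * (K\<^sup>2 + 2 * K^4)) * (norm (y - x))\<^sup>2"
proof -
  define d where "d = norm (y - x)"
  define E where "E = K\<^sup>2 + 2 * K^4"
  have d0: "0 \<le> d" by (simp add: d_def)
  have K2: "1 \<le> K\<^sup>2" using K by simp
  have K4: "K^4 = K\<^sup>2 * K\<^sup>2" by (simp add: power_add[symmetric])
  have "1 * K\<^sup>2 \<le> K^4" unfolding K4 using K2 by (intro mult_right_mono) auto
  then have E: "0 < E" "2 * K\<^sup>2 \<le> E" using K2 unfolding E_def by linarith+
  have dE: "d * E \<le> 1" using d E(1) by (simp add: \<delta>_def E_def d_def field_simps)
  have "1 / E \<le> 1 / (2 * K\<^sup>2)" using E K2 by (intro divide_left_mono mult_pos_pos) auto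
  then have "d \<le> 1 / (2 * K\<^sup>2)" using d by (simp add: \<delta>_def E_def d_def)
  note cl = close_lines[OF this[unfolded d_def]]
  define \<tau> where "\<tau> = t x y"
  have \<tau>: "\<bar>\<tau>\<bar> \<le> 2 * K\<^sup>2 * d" "\<bar>\<tau>\<bar> \<le> 1" using cl by (auto simp: \<tau>_def d_def)
  define p q where "p = M x (u x)" and "q = M y (u x + \<tau> *\<^sub>R rot (u x))"
  define N where "N = M y - M x"
  have nN: "norm N \<le> K * d" using taylor2D(5)[OF F_taylor] by (simp add: N_def d_def)
  have np: "norm p \<le> K" using norm_M_u by (simp add: p_def)
  have pp: "p \<bullet> p = (c x)\<^sup>2" by (simp add: p_def invariant power2_eq_square dot_square_norm unit)
  have My: "M y v = M x v + N v" for v by (simp add: N_def blinfun.diff_left)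
  have q: "q = p + N (u x) + \<tau> *\<^sub>R M y (rot (u x))"
    by (simp add: q_def p_def My blinfun.add_right blinfun.scaleR_right)
  have uy: "u y = (u x \<bullet> u y) *\<^sub>R (u x + \<tau> *\<^sub>R rot (u x))"
    unfolding \<tau>_def using cl(1) by (intro tan_angle_decomp unit) auto
  have "c y *\<^sub>R u (F y) = (u x \<bullet> u y) *\<^sub>R q"
    unfolding invariant[symmetric] q_def blinfun.scaleR_right[symmetric] uy[symmetric] ..
  moreover have "c x *\<^sub>R u (F x) = p" by (simp add: p_def invariant)
  ultimately have "tan_angle (c x *\<^sub>R u (F x)) (c y *\<^sub>R u (F y)) = tan_angle (1 *\<^sub>R p) ((u x \<bullet> u y) *\<^sub>R q)"
    by simp
  then have tF: "t (F x) (F y) = wedge p q / (p \<bullet> q)"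
    using c_ge[of x] c_ge[of y] cl(1) by (subst (asm) (1 2) tan_angle_scaleR) (auto simp: tan_angle_def)
  have bN: "\<bar>wedge p (N v)\<bar> \<le> K\<^sup>2 * d" "\<bar>p \<bullet> N v\<bar> \<le> K\<^sup>2 * d" if "norm v = 1" for v
  proof -
    have "norm p * norm (N v) \<le> K * (K * d * 1)"
      using K that by (intro mult_mono np norm_blinfun_apply_mono nN) auto
    then show "\<bar>wedge p (N v)\<bar> \<le> K\<^sup>2 * d" "\<bar>p \<bullet> N v\<bar> \<le> K\<^sup>2 * d"
      using abs_wedge_le[of p "N v"] Cauchy_Schwarz_ineq2[of p "N v"] by (auto simp: power2_eq_square)
  qed
  have num: "wedge p q = \<sigma> x * \<tau> + wedge p (N (u x)) + \<tau> * wedge p (N (rot (u x)))"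
  proof -
    \<comment> \<open>The determinant has absolute value 1, so the slope enters the numerator with a
      coefficient that is exactly a sign.\<close>
    have "wedge p (M x (rot (u x))) = \<sigma> x"
      unfolding p_def wedge_M by (simp add: wedge_rot unit)
    then show ?thesis
      unfolding q My by (simp add: wedge.add_right wedge.scaleR_right algebra_simps)
  qed
  define N0 where "N0 = \<sigma> x * \<tau> + \<beta> x (y - x)"
  have "wedge p q - N0 = wedge p ((N - H x (y - x)) (u x)) + \<tau> * wedge p (N (rot (u x)))"
    unfolding num N0_def \<beta> p_def[symmetric] by (simp add: blinfun.diff_left wedge.diff_right)
  also have "\<bar>\<dots>\<bar> \<le> K * (K * d\<^sup>2 * 1) + (2 * K\<^sup>2 * d) * (K\<^sup>2 * d)"
  proof (intro order_trans[OF abs_triangle_ineq] add_mono)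
    show "\<bar>wedge p ((N - H x (y - x)) (u x))\<bar> \<le> K * (K * d\<^sup>2 * 1)"
      unfolding N_def d_def
      using K by (intro order_trans[OF abs_wedge_le] mult_mono np norm_blinfun_apply_mono taylor2D(7)[OF F_taylor])
         (auto simp: unit)
    show "\<bar>\<tau> * wedge p (N (rot (u x)))\<bar> \<le> (2 * K\<^sup>2 * d) * (K\<^sup>2 * d)"
      unfolding abs_mult using \<tau>(1) d0 by (intro mult_mono bN) (auto simp: unit)
  qed
  also have "\<dots> = E * d\<^sup>2" unfolding E_def by algebra
  finally have e1: "\<bar>wedge p q - N0\<bar> \<le> E * d\<^sup>2" .
  have e2: "\<bar>wedge p q\<bar> \<le> 4 * K\<^sup>2 * d"
  proof -
    have "\<bar>\<tau> * wedge p (N (rot (u x)))\<bar> \<le> 1 * (K\<^sup>2 * d)"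
      unfolding abs_mult using \<tau>(2) d0 by (intro mult_mono bN) (auto simp: unit)
    moreover have "\<bar>\<sigma> x * \<tau>\<bar> \<le> 2 * K\<^sup>2 * d" using \<tau>(1) by (simp add: abs_mult abs_\<sigma>)
    ultimately show ?thesis unfolding num using bN(1)[OF unit[of x]] by linarith
  qed
  have e3: "\<bar>p \<bullet> q - (c x)\<^sup>2\<bar> \<le> E * d"
  proof -
    have "norm p * norm (M y (rot (u x))) \<le> K * (K * 1)"
      using K by (intro mult_mono np norm_blinfun_apply_mono taylor2D(2)[OF F_taylor]) (auto simp: unit)
    then have "\<bar>\<tau> * (p \<bullet> M y (rot (u x)))\<bar> \<le> (2 * K\<^sup>2 * d) * K\<^sup>2"
      unfolding abs_mult using \<tau>(1) d0 Cauchy_Schwarz_ineq2[of p "M y (rot (u x))"]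
      by (intro mult_mono) (auto simp: power2_eq_square)
    moreover have "p \<bullet> q - (c x)\<^sup>2 = p \<bullet> N (u x) + \<tau> * (p \<bullet> M y (rot (u x)))"
      unfolding q by (simp add: inner_add_right pp)
    moreover have "E * d = K\<^sup>2 * d + (2 * K\<^sup>2 * d) * K\<^sup>2" unfolding E_def by algebra
    ultimately show ?thesis using bN(2)[OF unit[of x]] by linarith
  qed
  have den: "1 \<le> p \<bullet> q" using e3 dE c2_ge[of x] by (simp add: mult.commute)
  have cpos: "1 \<le> (c x)\<^sup>2" using c2_ge[of x] by linarith
  \<comment> \<open>The numerator is itself of order \<open>d\<close>, so the error of order
    \<open>d\<close> in the denominator contributes only at order \<open>d\<^sup>2\<close>.\<close>
  have "t (F x) (F y) - N0 / (c x)\<^sup>2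
      = (wedge p q - N0) / (c x)\<^sup>2 + wedge p q * ((c x)\<^sup>2 - p \<bullet> q) / (p \<bullet> q * (c x)\<^sup>2)"
  proof -
    have "a / r - n / b = (a - n) / b + a * (b - r) / (r * b)" if "r \<noteq> 0" "b \<noteq> 0" for a r n b :: real
      using that by (simp add: field_simps)
    then show ?thesis unfolding tF using den cpos by (metis not_one_le_zero)
  qed
  also have "\<bar>\<dots>\<bar> \<le> E * d\<^sup>2 + 4 * K\<^sup>2 * d * (E * d)"
  proof (intro order_trans[OF abs_triangle_ineq] add_mono)
    have "\<bar>(wedge p q - N0) / (c x)\<^sup>2\<bar> \<le> \<bar>wedge p q - N0\<bar> / 1"
      unfolding abs_divide using cpos by (intro divide_mono) auto
    then show "\<bar>(wedge p q - N0) / (c x)\<^sup>2\<bar> \<le> E * d\<^sup>2" using e1 by simp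
    have "1 * 1 \<le> (p \<bullet> q) * (c x)\<^sup>2" using den cpos by (intro mult_mono) auto
    moreover have "\<bar>wedge p q * ((c x)\<^sup>2 - p \<bullet> q)\<bar> \<le> 4 * K\<^sup>2 * d * (E * d)"
      unfolding abs_mult using e2 e3 K2 d0 by (intro mult_mono) (auto simp: abs_minus_commute)
    ultimately show "\<bar>wedge p q * ((c x)\<^sup>2 - p \<bullet> q) / (p \<bullet> q * (c x)\<^sup>2)\<bar> \<le> 4 * K\<^sup>2 * d * (E * d)"
      unfolding abs_divide using divide_mono[of 1 "\<bar>p \<bullet> q * (c x)\<^sup>2\<bar>"] by force
  qed
  finally show ?thesis
    by (simp add: N0_def \<tau>_def E_def d_def power2_eq_square algebra_simps)
qed

text \<open>\<open>A\<close> solves the equation that results from differentiating the recursion in \<open>tan_angle_step\<close>.\<close>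

lemma derivative_cocycle:
  "\<exists>A. \<forall>x. A x = (1 / (c (G x))\<^sup>2) *\<^sub>R ((\<sigma> (G x) *\<^sub>R A (G x) + \<beta> (G x)) o\<^sub>L MG x) \<and> norm (A x) \<le> 2 * K^3"
proof (rule bounded_fibre_contraction_fixpoint[where L =
      "\<lambda>x B. (1 / (c (G x))\<^sup>2) *\<^sub>R ((\<sigma> (G x) *\<^sub>R B + \<beta> (G x)) o\<^sub>L MG x)"])
  fix x and v w :: "(real^2) \<Rightarrow>\<^sub>L real"
  define a where "a = \<bar>c (G x)\<bar>"
  have a: "4 \<le> a" "4 * C\<^sub>0 \<le> a" using c_ge gap by (auto simp: a_def)
  have "(1 / (c (G x))\<^sup>2) *\<^sub>R ((\<sigma> (G x) *\<^sub>R v + \<beta> (G x)) o\<^sub>L MG x)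
      - (1 / (c (G x))\<^sup>2) *\<^sub>R ((\<sigma> (G x) *\<^sub>R w + \<beta> (G x)) o\<^sub>L MG x)
      = (1 / (c (G x))\<^sup>2) *\<^sub>R ((\<sigma> (G x) *\<^sub>R (v - w)) o\<^sub>L MG x)"
    by (rule blinfun_eqI) (simp add: blinfun.bilinear_simps algebra_simps)
  \<comment> \<open>The slope factor \<open>1 / a\<^sup>2\<close> outweighs the factor
    \<open>C\<^sub>0 * a\<close> of \<open>MG\<close>; what remains is \<open>C\<^sub>0 / a\<close>,
    at most \<open>1/4\<close>.\<close>
  also have "norm \<dots> \<le> (1 / a\<^sup>2) * (norm (v - w) * (C\<^sub>0 * a))"
    unfolding norm_scaleR a_def
    by (intro mult_mono norm_blinfun_compose_mono norm_MG) (auto simp: abs_\<sigma>)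
  also have "\<dots> = norm (v - w) * (C\<^sub>0 / a)" using a by (simp add: power2_eq_square)
  also have "\<dots> \<le> norm (v - w) * (1 / 2)"
    using a C\<^sub>0 by (intro mult_left_mono) (auto simp: field_simps)
  finally show "norm ((1 / (c (G x))\<^sup>2) *\<^sub>R ((\<sigma> (G x) *\<^sub>R v + \<beta> (G x)) o\<^sub>L MG x)
      - (1 / (c (G x))\<^sup>2) *\<^sub>R ((\<sigma> (G x) *\<^sub>R w + \<beta> (G x)) o\<^sub>L MG x)) \<le> norm (v - w) / 2" by simp
next
  fix x
  have "norm ((1 / (c (G x))\<^sup>2) *\<^sub>R ((\<sigma> (G x) *\<^sub>R 0 + \<beta> (G x)) o\<^sub>L MG x)) \<le> 1 * (K\<^sup>2 * K)"
    unfolding norm_scaleR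
  proof (intro mult_mono norm_blinfun_compose_mono taylor2D(2)[OF G_taylor])
    show "\<bar>1 / (c (G x))\<^sup>2\<bar> \<le> 1"
      using c2_ge[of "G x"] divide_left_mono[of 1 "(c (G x))\<^sup>2" 1] by (cases "c (G x) = 0") auto
  qed (use norm_\<beta>[of "G x"] in auto)
  then show "norm ((1 / (c (G x))\<^sup>2) *\<^sub>R ((\<sigma> (G x) *\<^sub>R 0 + \<beta> (G x)) o\<^sub>L MG x)) \<le> K^3"
    by (simp add: power2_eq_square power3_eq_cube)
qed

text \<open>The exponents compete here: \<open>\<bar>c x\<bar> powr (1 + \<gamma>)\<close> from the
  distances against \<open>(c x)\<^sup>2\<close> from the slopes. The surplus
  \<open>\<bar>c x\<bar> powr (1 - \<gamma>)\<close> absorbs \<open>(2 * C\<^sub>0) powr (1 +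
  \<gamma>) \<le> 4 * C\<^sub>0\<^sup>2\<close> and leaves \<open>1/2\<close>.\<close>

lemma rescaled_power_le:
  assumes "0 \<le> D" "0 \<le> d" "d \<le> 2 * C\<^sub>0 * \<bar>c x\<bar> * D"
  shows "d powr (1 + \<gamma>) / (c x)\<^sup>2 \<le> D powr (1 + \<gamma>) / 2"
proof -
  define a where "a = \<bar>c x\<bar>"
  have a: "4 \<le> a" using c_ge by (simp add: a_def)
  have "d powr (1 + \<gamma>) \<le> (2 * C\<^sub>0 * a * D) powr (1 + \<gamma>)"
    using assms \<gamma> by (intro powr_mono2) (auto simp: a_def)
  also have "\<dots> = (2 * C\<^sub>0) powr (1 + \<gamma>) * (a powr (1 + \<gamma>) * D powr (1 + \<gamma>))"
    using assms a C\<^sub>0 by (simp add: powr_mult)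
  also have "(2 * C\<^sub>0) powr (1 + \<gamma>) \<le> (2 * C\<^sub>0) powr 2"
    using C\<^sub>0 \<gamma> by (intro powr_mono) auto
  also have "(2 * C\<^sub>0) powr 2 = 4 * C\<^sub>0\<^sup>2" using C\<^sub>0 by (simp add: power2_eq_square)
  also have "4 * C\<^sub>0\<^sup>2 \<le> a powr (1 - \<gamma>) / 2" using gap(2)[of x] by (simp add: a_def)
  finally have "d powr (1 + \<gamma>) \<le> a powr (1 - \<gamma>) / 2 * (a powr (1 + \<gamma>) * D powr (1 + \<gamma>))"
    by (simp add: mult_right_mono)
  also have "\<dots> = (a powr (1 - \<gamma>) * a powr (1 + \<gamma>)) * (D powr (1 + \<gamma>) / 2)" by simp
  also have "a powr (1 - \<gamma>) * a powr (1 + \<gamma>) = (c x)\<^sup>2"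
    using a by (simp add: powr_add[symmetric] a_def)
  finally show ?thesis using c2_ge[of x] pos_divide_le_eq[of "(c x)\<^sup>2" "d powr (1 + \<gamma>)" "D powr (1 + \<gamma>) / 2"]
    by (cases "c x = 0") (auto simp: mult.commute)
qed

text \<open>Subtracting the equation for \<open>A\<close> from the slope recursion cancels the
  linear terms and leaves a recursion for the remainder \<open>R\<close> with a quadratic source.
  Iterated backwards with \<open>rescaled_power_le\<close>, it yields the exponent
  \<open>1 + \<gamma>\<close>, while the a priori bound \<open>B0\<close> is multiplied by
  \<open>(1/2)^n\<close>.\<close>

lemma tan_angle_first_order:
  "\<exists>\<delta> \<Lambda> A. 0 < \<delta> \<and> 0 < \<Lambda> \<and> (\<forall>x. norm (A x :: (real^2) \<Rightarrow>\<^sub>L real) \<le> \<Lambda>) \<and>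
     (\<forall>x y. norm (y - x) \<le> \<delta> \<longrightarrow> u x \<bullet> u y \<noteq> 0 \<and> \<bar>t x y\<bar> \<le> 1 \<and> \<bar>t x y\<bar> \<le> \<Lambda> * norm (y - x) \<and>
        \<bar>t x y - A x (y - x)\<bar> \<le> \<Lambda> * norm (y - x) powr (1 + \<gamma>))"
proof -
  obtain A where A: "A x = (1 / (c (G x))\<^sup>2) *\<^sub>R ((\<sigma> (G x) *\<^sub>R A (G x) + \<beta> (G x)) o\<^sub>L MG x)"
    and nA: "norm (A x) \<le> 2 * K^3" for x
    using derivative_cocycle by blast
  define E where "E = K\<^sup>2 + 2 * K^4"
  define \<delta> where "\<delta> = 1 / E"
  define K5 where "K5 = K\<^sup>2 + 2 * K^4 + 4 * K\<^sup>2 * (K\<^sup>2 + 2 * K^4)"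
  define R where "R x y = t x y - A x (y - x)" for x y
  define K7 where "K7 = (2 * K^3 + K\<^sup>2) * K + K5 * K\<^sup>2"
  define B0 where "B0 = 1 + 2 * K^3"
  \<comment> \<open>Points at distance at most \<open>\<eta>\<close> have preimages at distance at
    most \<open>\<delta>\<close>, so the induction hypothesis applies to the preimages.\<close>
  define \<eta> where "\<eta> = \<delta> / K"
  \<comment> \<open>One summand for each use: the quadratic source, pairs too far apart for the
    recursion, the Lipschitz bound of the slope, and the norm of \<open>A\<close>.\<close>
  define \<Lambda> where "\<Lambda> = 2 * K7 + B0 / \<eta>\<^sup>2 + 2 * K\<^sup>2 + 2 * K^3"
  have K2: "1 \<le> K\<^sup>2" "1 \<le> K^3" "1 \<le> K^4" using K by (simp_all add: one_le_power)
  have E: "0 < E" "2 * K\<^sup>2 \<le> E" "K \<le> E" "1 \<le> E"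
  proof -
    have K4: "K^4 = K\<^sup>2 * K\<^sup>2" by (simp add: power_add[symmetric])
    show "0 < E" "1 \<le> E" using K2 unfolding E_def by linarith+
    have "1 * K\<^sup>2 \<le> K^4" unfolding K4 using K2 by (intro mult_right_mono) auto
    then show "2 * K\<^sup>2 \<le> E" using K2 unfolding E_def by linarith
    then show "K \<le> E" using K K2 self_le_power[of K 2] by linarith
  qed
  have \<delta>: "0 < \<delta>" "\<delta> \<le> 1 / (2 * K\<^sup>2)" "\<delta> \<le> 1 / K" "\<delta> \<le> 1"
    using E K K2 unfolding \<delta>_def by (auto intro!: divide_left_mono simp: field_simps)
  have \<eta>: "0 < \<eta>" "\<eta> \<le> \<delta>" "K * \<eta> = \<delta>" "\<eta> \<le> 1"
  proof -
    show "0 < \<eta>" "K * \<eta> = \<delta>" using \<delta> K by (auto simp: \<eta>_def)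
    have "\<delta> / K \<le> \<delta> / 1" using \<delta> K by (intro divide_left_mono) auto
    then show "\<eta> \<le> \<delta>" "\<eta> \<le> 1" using \<delta> by (auto simp: \<eta>_def)
  qed
  have K7: "0 \<le> K7" "0 \<le> B0" using K by (auto simp: K7_def K5_def B0_def)
  have \<Lambda>: "2 * K7 \<le> \<Lambda>" "B0 \<le> \<Lambda> * \<eta>\<^sup>2" "2 * K\<^sup>2 \<le> \<Lambda>" "2 * K^3 \<le> \<Lambda>" "0 < \<Lambda>"
  proof -
    have "0 \<le> B0 / \<eta>\<^sup>2" using K7 by simp
    then show "2 * K7 \<le> \<Lambda>" "2 * K\<^sup>2 \<le> \<Lambda>" "2 * K^3 \<le> \<Lambda>" "0 < \<Lambda>" using K7 K2 unfolding \<Lambda>_def by linarith+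
    have "B0 / \<eta>\<^sup>2 \<le> \<Lambda>" using K7 K2 unfolding \<Lambda>_def by linarith
    then show "B0 \<le> \<Lambda> * \<eta>\<^sup>2" using \<eta> by (simp add: field_simps)
  qed
  have R_bound: "\<bar>R X Y\<bar> \<le> B0" if "norm (Y - X) \<le> \<delta>" for X Y
  proof -
    have "norm (A X (Y - X)) \<le> 2 * K^3 * 1"
      using that \<delta> by (intro norm_blinfun_apply_mono nA) auto
    then show ?thesis using close_lines(3)[of Y X] that \<delta> by (simp add: R_def B0_def)
  qed
  have R_step: "\<bar>R X Y\<bar> \<le> \<bar>R (G X) (G Y)\<bar> / (c (G X))\<^sup>2 + K7 * (norm (Y - X))\<^sup>2"
    if D: "norm (Y - X) \<le> \<eta>" for X Y
  proof -
    define x y where "x = G X" and "y = G Y"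
    define D where "D = norm (Y - X)"
    define b where "b = (c x)\<^sup>2"
    have b: "4 \<le> b" using c2_ge by (simp add: b_def)
    \<comment> \<open>The second order defect of \<open>G\<close>; \<open>A x\<close> and
      \<open>\<beta> x\<close> are linear and bounded, so they turn it into a quadratic
      error.\<close>
    define z where "z = y - x - MG X (Y - X)"
    have nz: "norm z \<le> K * D\<^sup>2" using taylor2D(6)[OF G_taylor] by (simp add: z_def x_def y_def D_def)
    have dD: "norm (y - x) \<le> K * D" using taylor2D(4)[OF G_taylor] by (simp add: x_def y_def D_def)
    also have "\<dots> \<le> \<delta>" using that \<eta> K by (metis D_def mult_left_mono order_trans zero_le_one)
    finally have d: "norm (y - x) \<le> 1 / (K\<^sup>2 + 2 * K^4)" by (simp add: \<delta>_def E_def)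
    define e where "e = t X Y - (\<sigma> x * t x y + \<beta> x (y - x)) / b"
    have "\<bar>e\<bar> \<le> K5 * (norm (y - x))\<^sup>2"
      using tan_angle_step[OF d] by (simp add: e_def b_def K5_def x_def y_def F_G)
    also have "\<dots> \<le> K5 * (K * D)\<^sup>2"
      using K by (intro mult_left_mono power_mono dD) (auto simp: K5_def)
    finally have e: "\<bar>e\<bar> \<le> K5 * K\<^sup>2 * D\<^sup>2" by (simp add: power_mult_distrib)
    have AX: "A X (Y - X) = (\<sigma> x * A x (MG X (Y - X)) + \<beta> x (MG X (Y - X))) / b"
      by (subst A) (simp add: x_def b_def blinfun.add_left blinfun.scaleR_left)
    have MGz: "MG X (Y - X) = y - x - z" by (simp add: z_def)
    have "R X Y = \<sigma> x * R x y / b + (\<sigma> x * A x z + \<beta> x z) / b + e"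
      unfolding R_def AX MGz e_def by (simp add: blinfun.bilinear_simps diff_divide_distrib add_divide_distrib algebra_simps)
    also have "\<bar>\<dots>\<bar> \<le> \<bar>R x y\<bar> / b + (2 * K^3 + K\<^sup>2) * (K * D\<^sup>2) + K5 * K\<^sup>2 * D\<^sup>2"
    proof (intro order_trans[OF abs_triangle_ineq] add_mono e)
      show "\<bar>\<sigma> x * R x y / b\<bar> \<le> \<bar>R x y\<bar> / b" using b by (simp add: abs_mult abs_\<sigma>)
      have "norm (A x z) \<le> 2 * K^3 * (K * D\<^sup>2)" "norm (\<beta> x z) \<le> K\<^sup>2 * (K * D\<^sup>2)"
        by (intro norm_blinfun_apply_mono nA norm_\<beta> nz)+
      moreover have "\<bar>(\<sigma> x * A x z + \<beta> x z) / b\<bar> \<le> \<bar>\<sigma> x * A x z + \<beta> x z\<bar> / 1"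
        unfolding abs_divide using b by (intro divide_left_mono) auto
      moreover have "\<bar>\<sigma> x * A x z + \<beta> x z\<bar> \<le> \<bar>A x z\<bar> + \<bar>\<beta> x z\<bar>"
        using abs_triangle_ineq[of "\<sigma> x * A x z" "\<beta> x z"] by (simp add: abs_mult abs_\<sigma>)
      ultimately show "\<bar>(\<sigma> x * A x z + \<beta> x z) / b\<bar> \<le> (2 * K^3 + K\<^sup>2) * (K * D\<^sup>2)"
        by (simp add: distrib_right)
    qed
    finally show ?thesis by (simp add: K7_def b_def x_def y_def D_def algebra_simps)
  qed
  have main: "\<bar>R X Y\<bar> \<le> \<Lambda> * norm (Y - X) powr (1 + \<gamma>) + (1/2)^n * B0" if "norm (Y - X) \<le> \<delta>" for X Y n
    using that
  proof (induction n arbitrary: X Y)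
    case 0
    have "0 \<le> \<Lambda> * norm (Y - X) powr (1 + \<gamma>)" using \<Lambda>(5) by simp
    then show ?case using R_bound[OF 0] by simp
  next
    case (Suc n)
    define D where "D = norm (Y - X)"
    have D1: "0 \<le> D" "D \<le> 1" using Suc.prems \<delta> by (auto simp: D_def)
    have pos: "0 \<le> (1/2)^Suc n * B0" using K7 by simp
    show ?case
    proof (cases "D \<le> \<eta>")
      case False
      have "\<eta>\<^sup>2 = \<eta> powr 2" using \<eta> by simp
      also have "\<dots> \<le> \<eta> powr (1 + \<gamma>)" using \<eta> \<gamma> by (intro powr_mono') auto
      also have "\<dots> \<le> D powr (1 + \<gamma>)" using \<eta> \<gamma> False by (intro powr_mono2) auto
      finally have "\<Lambda> * \<eta>\<^sup>2 \<le> \<Lambda> * D powr (1 + \<gamma>)" using \<Lambda> by (intro mult_left_mono) auto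
      then show ?thesis using R_bound[OF Suc.prems] \<Lambda>(2) pos unfolding D_def by linarith
    next
      case True
      define x y where "x = G X" and "y = G Y"
      define d where "d = norm (y - x)"
      have "d \<le> K * D" using taylor2D(4)[OF G_taylor] by (simp add: d_def x_def y_def D_def)
      also have "\<dots> \<le> \<delta>" using True \<eta> K by (metis mult_left_mono order_trans zero_le_one)
      finally have IH: "\<bar>R x y\<bar> \<le> \<Lambda> * d powr (1 + \<gamma>) + (1/2)^n * B0"
        unfolding d_def by (rule Suc.IH)
      have "d \<le> 2 * C\<^sub>0 * \<bar>c x\<bar> * D"
        unfolding d_def x_def y_def D_def by (rule G_expansion) (use True \<eta> \<delta> in \<open>auto simp: D_def\<close>)
      then have dD: "d powr (1 + \<gamma>) / (c x)\<^sup>2 \<le> D powr (1 + \<gamma>) / 2"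
        using D1 by (intro rescaled_power_le) (auto simp: d_def)
      have D2: "D\<^sup>2 \<le> D powr (1 + \<gamma>)"
      proof -
        have "D powr 2 \<le> D powr (1 + \<gamma>)" using D1 \<gamma> by (intro powr_mono') auto
        then show ?thesis using D1 by simp
      qed
      have "\<bar>R X Y\<bar> \<le> \<bar>R x y\<bar> / (c x)\<^sup>2 + K7 * D\<^sup>2"
        using R_step[of Y X] True by (simp add: D_def x_def y_def)
      also have "\<dots> \<le> (\<Lambda> * d powr (1 + \<gamma>) + (1/2)^n * B0) / (c x)\<^sup>2 + K7 * D powr (1 + \<gamma>)"
        using IH D2 K7 by (intro add_mono divide_right_mono mult_left_mono) auto
      also have "\<dots> = \<Lambda> * (d powr (1 + \<gamma>) / (c x)\<^sup>2) + (1/2)^n * B0 / (c x)\<^sup>2 + K7 * D powr (1 + \<gamma>)"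
        by (simp add: add_divide_distrib)
      \<comment> \<open>One half of \<open>\<Lambda>\<close> is what the recursion returns, the
        other half pays for the source.\<close>
      also have "\<dots> \<le> \<Lambda> * (D powr (1 + \<gamma>) / 2) + (1/2)^n * B0 / 2 + (\<Lambda> / 2) * D powr (1 + \<gamma>)"
        using dD \<Lambda> K7 c2_ge[of x] by (intro add_mono mult_left_mono divide_left_mono mult_right_mono) auto
      finally show ?thesis by (simp add: D_def)
    qed
  qed
  have R: "\<bar>R x y\<bar> \<le> \<Lambda> * norm (y - x) powr (1 + \<gamma>)" if "norm (y - x) \<le> \<delta>" for x y
    using main[OF that] by (rule le_of_le_add_half_powers)
  show ?thesis
  proof (intro exI conjI allI impI)
    show "0 < \<delta>" "0 < \<Lambda>" using \<delta> \<Lambda> by auto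
    show "norm (A x) \<le> \<Lambda>" for x using nA[of x] \<Lambda> by linarith
    fix x y :: "real^2" assume d: "norm (y - x) \<le> \<delta>"
    note cl = close_lines[OF order_trans[OF d \<delta>(2)]]
    show "u x \<bullet> u y \<noteq> 0" "\<bar>t x y\<bar> \<le> 1" using cl by auto
    show "\<bar>t x y\<bar> \<le> \<Lambda> * norm (y - x)"
      using cl(2) mult_right_mono[OF \<Lambda>(3), of "norm (y - x)"] by simp
    show "\<bar>t x y - A x (y - x)\<bar> \<le> \<Lambda> * norm (y - x) powr (1 + \<gamma>)" using R[OF d] by (simp add: R_def)
  qed
qed

end

section \<open>Local Hoelder generators\<close>

text \<open>The Hoelder bound for the derivative compares the expansions at \<open>a\<close> and at \<open>x\<close> in a third
  point \<open>z\<close> at distance \<open>norm (a - x)\<close> from \<open>x\<close>.\<close>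

lemma holder_on_of_first_order:
  fixes f :: "'a::euclidean_space \<Rightarrow> real" and f' :: "'a \<Rightarrow> 'a \<Rightarrow>\<^sub>L real"
  assumes U: "open U" and \<beta>: "\<beta> \<le> 1 + \<gamma>" and \<gamma>: "0 < \<gamma>" "\<gamma> < 1" and L: "0 < L"
    and lip: "\<And>x y. x \<in> U \<Longrightarrow> y \<in> U \<Longrightarrow> \<bar>f y - f x\<bar> \<le> L * norm (y - x)"
    and fo: "\<And>x y. x \<in> U \<Longrightarrow> y \<in> U \<Longrightarrow> \<bar>f y - f x - f' x (y - x)\<bar> \<le> L * norm (y - x) powr (1 + \<gamma>)"
  shows "holder_on \<beta> f U"
proof (cases "\<beta> < 1")
  case True
  \<comment> \<open>This case includes negative \<open>\<beta>\<close>. For distances at most 1 a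
    Lipschitz bound implies the bound with any exponent below 1.\<close>
  then have fl: "nat \<lfloor>\<beta>\<rfloor> = 0" by linarith
  have "\<bar>f a - f x\<bar> \<le> L * norm (a - x) powr \<beta>" if "a \<in> U" "x \<in> U" "norm (a - x) \<le> 1" for a x
  proof (cases "a = x")
    case False
    then have "norm (a - x) powr 1 \<le> norm (a - x) powr \<beta>"
      using True that by (intro powr_mono') auto
    then show ?thesis
      using lip[of x a] that L by (smt (verit) mult_left_mono norm_ge_zero powr_one)
  qed simp
  then have "\<exists>d>0. \<exists>K>0. \<forall>x\<in>U. norm (a - x) \<le> d \<longrightarrow> \<bar>f a - f x\<bar> \<le> K * norm (a - x) powr \<beta>" if "a \<in> U" for a
    using L that by (metis zero_less_one)
  then show ?thesis
    unfolding holder_on_def fl times_differentiable_on_def by simp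
next
  case False
  then have fl: "nat \<lfloor>\<beta>\<rfloor> = 1" using \<beta> \<gamma> by linarith
  have der: "(f has_derivative f' x) (at x)" if x: "x \<in> U" for x
  proof (rule has_derivativeI)
    show "bounded_linear (blinfun_apply (f' x))" by (rule blinfun.bounded_linear_right)
    have "((\<lambda>y. L * norm (y - x) powr \<gamma>) \<longlongrightarrow> L * 0) (at x)"
      using \<gamma> by (intro tendsto_mult tendsto_const)
        (auto intro!: tendsto_zero_powrI[where b = \<gamma>] LIM_zero tendsto_ident_at simp: tendsto_norm_zero_iff)
    then have lim: "((\<lambda>y. L * norm (y - x) powr \<gamma>) \<longlongrightarrow> 0) (at x)" by simp
    show "((\<lambda>y. (f y - f x - f' x (y - x)) /\<^sub>R norm (y - x)) \<longlongrightarrow> 0) (at x)"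
    proof (rule Lim_null_comparison[OF _ lim])
      have "norm ((f y - f x - f' x (y - x)) /\<^sub>R norm (y - x)) \<le> L * norm (y - x) powr \<gamma>"
        if "y \<in> U" "y \<noteq> x" for y
      proof -
        have "norm (y - x) powr (1 + \<gamma>) = norm (y - x) * norm (y - x) powr \<gamma>"
          using that by (simp add: powr_add)
        then show ?thesis
          using fo[OF x that(1)] that(2)
          by (simp add: divide_inverse_commute[symmetric] pos_divide_le_eq mult_ac abs_mult)
      qed
      then show "\<forall>\<^sub>F y in at x. norm ((f y - f x - f' x (y - x)) /\<^sub>R norm (y - x)) \<le> L * norm (y - x) powr \<gamma>"
        unfolding eventually_at_topological using U x by blast
    qed
  qed
  have partials_f: "partials [v] f x = f' x v" if "x \<in> U" for x v
    by (simp add: frechet_derivative_at[OF der[OF that], symmetric])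
  have "\<exists>d>0. \<exists>K>0. \<forall>x\<in>U. norm (a - x) \<le> d \<longrightarrow>
      (\<forall>v\<in>Basis. \<bar>f' a v - f' x v\<bar> \<le> K * norm (a - x) powr (\<beta> - 1))" if a: "a \<in> U" for a
  proof -
    obtain r where r: "0 < r" "cball a r \<subseteq> U" using U a open_contains_cball by blast
    \<comment> \<open>The third point may be twice as far from \<open>a\<close> as \<open>x\<close>
      is, and it must stay in \<open>U\<close>.\<close>
    define d where "d = min 1 (r / 2)"
    have "\<bar>f' a v - f' x v\<bar> \<le> 6 * L * norm (a - x) powr (\<beta> - 1)"
      if x: "x \<in> U" "norm (a - x) \<le> d" and v: "v \<in> Basis" for x v
    proof (cases "a = x")
      case ne: False
      define h where "h = norm (a - x)"
      have h: "0 < h" "h \<le> 1" "2 * h \<le> r" using x ne by (auto simp: h_def d_def)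
      define z where "z = x + h *\<^sub>R v"
      have za: "norm (z - a) \<le> 2 * h"
      proof -
        have "norm (z - a) \<le> norm (x - a) + norm (h *\<^sub>R v)"
          unfolding z_def by (metis add_diff_eq add.commute norm_triangle_ineq)
        then show ?thesis using v h by (simp add: h_def norm_minus_commute)
      qed
      then have "z \<in> U" using r h by (intro subsetD[OF r(2)]) (auto simp: dist_norm norm_minus_commute)
      have 1: "\<bar>f z - f x - f' x (h *\<^sub>R v)\<bar> \<le> L * h powr (1 + \<gamma>)"
        using fo[OF x(1) \<open>z \<in> U\<close>] v h by (simp add: z_def)
      have 2: "\<bar>f x - f a - f' a (x - a)\<bar> \<le> L * h powr (1 + \<gamma>)"
        using fo[OF a x(1)] by (simp add: h_def norm_minus_commute)
      have "\<bar>f z - f a - f' a (z - a)\<bar> \<le> L * norm (z - a) powr (1 + \<gamma>)"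
        by (rule fo[OF a \<open>z \<in> U\<close>])
      also have "\<dots> \<le> L * (2 * h) powr (1 + \<gamma>)"
        using za L \<gamma> by (intro mult_left_mono powr_mono2) auto
      also have "(2 * h) powr (1 + \<gamma>) = 2 powr (1 + \<gamma>) * h powr (1 + \<gamma>)"
        using h by (simp add: powr_mult)
      also have "2 powr (1 + \<gamma>) \<le> (2::real) powr 2" using \<gamma> by (intro powr_mono) auto
      finally have 3: "\<bar>f z - f a - f' a (z - a)\<bar> \<le> 4 * (L * h powr (1 + \<gamma>))"
        using L by (simp add: mult_left_mono mult_right_mono)
      have "f' a (z - a) = f' a (x - a) + f' a (h *\<^sub>R v)"
        by (simp add: z_def blinfun.bilinear_simps)
      \<comment> \<open>The constant is 1 + 1 + 4, with 4 bounding
        \<open>2 powr (1 + \<gamma>)\<close> for the pair at distance up to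
        \<open>2 * h\<close>.\<close>
      then have "\<bar>f' a (h *\<^sub>R v) - f' x (h *\<^sub>R v)\<bar> \<le> 6 * (L * h powr (1 + \<gamma>))"
        using 1 2 3 by linarith
      then have "h * \<bar>f' a v - f' x v\<bar> \<le> h * (6 * L * h powr \<gamma>)"
        using h by (simp add: blinfun.scaleR_right right_diff_distrib[symmetric] abs_mult powr_add mult_ac)
      then have "\<bar>f' a v - f' x v\<bar> \<le> 6 * L * h powr \<gamma>" using h by simp
      also have "\<dots> \<le> 6 * L * h powr (\<beta> - 1)"
        using h \<beta> L by (intro mult_left_mono powr_mono') auto
      finally show ?thesis by (simp add: h_def)
    qed (use L in simp)
    then show ?thesis using r L by (intro exI[of _ d] exI[of _ "6 * L"] conjI) (auto simp: d_def)
  qed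
  note bound = this
  show ?thesis
    unfolding holder_on_def fl times_differentiable_on_def
  proof (intro conjI allI impI ballI)
    fix vs :: "'a list" and x assume "set vs \<subseteq> Basis \<and> length vs < 1" "x \<in> U"
    then show "partials vs f differentiable at x" using der by (auto simp: differentiable_def)
  next
    fix a assume a: "a \<in> U"
    then obtain d K where dK: "d > 0" "K > 0" and
      *: "\<And>x v. x \<in> U \<Longrightarrow> norm (a - x) \<le> d \<Longrightarrow> v \<in> Basis \<Longrightarrow> \<bar>f' a v - f' x v\<bar> \<le> K * norm (a - x) powr (\<beta> - 1)"
      using bound by blast
    have "\<bar>partials vs f a - partials vs f x\<bar> \<le> K * norm (a - x) powr (\<beta> - real 1)"
      if "x \<in> U" "norm (a - x) \<le> d" and vs: "set vs \<subseteq> Basis \<and> length vs = 1" for x vs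
    proof -
      obtain v where "vs = [v]" "v \<in> Basis"
        using vs by (cases vs) auto
      then show ?thesis using *[OF that(1,2)] partials_f a that(1) by (simp del: partials.simps)
    qed
    then show "\<exists>d>0. \<exists>K>0. \<forall>x\<in>U. norm (a - x) \<le> d \<longrightarrow>
        (\<forall>vs. set vs \<subseteq> Basis \<and> length vs = 1 \<longrightarrow>
           \<bar>partials vs f a - partials vs f x\<bar> \<le> K * norm (a - x) powr (\<beta> - real 1))"
      using dK by blast
  qed
qed

context expanding_line_field
begin

text \<open>Near \<open>x0\<close> each line is described by its slope \<open>s\<close> over the
  fixed vector \<open>u x0\<close>. The generator with component 1 along that vector does not see
  the signs of \<open>u\<close>, and its coordinates are affine functions of
  \<open>s\<close>.\<close>

lemma local_holder_generator:
  assumes b: "b \<le> 1 + \<gamma>" and \<gamma>0: "0 < \<gamma>"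
  shows "\<exists>r>0. \<exists>X. (\<forall>i. holder_on b (\<lambda>x. X x $ i) (ball x0 r)) \<and>
     (\<forall>x\<in>ball x0 r. X x \<noteq> 0 \<and> span {X x} = span {u x})"
proof -
  obtain \<delta> \<Lambda> A where \<delta>: "0 < \<delta>" and \<Lambda>: "0 < \<Lambda>" and nA: "\<And>x. norm (A x :: (real^2) \<Rightarrow>\<^sub>L real) \<le> \<Lambda>"
    and fo: "\<And>x y. norm (y - x) \<le> \<delta> \<Longrightarrow> u x \<bullet> u y \<noteq> 0 \<and> \<bar>t x y\<bar> \<le> 1 \<and> \<bar>t x y\<bar> \<le> \<Lambda> * norm (y - x) \<and>
        \<bar>t x y - A x (y - x)\<bar> \<le> \<Lambda> * norm (y - x) powr (1 + \<gamma>)"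
    using tan_angle_first_order by blast
  \<comment> \<open>Two points of the ball are then at distance at most \<open>\<delta>\<close> and
    at most 1.\<close>
  define r where "r = min (1/2) (\<delta> / 2)"
  have r: "0 < r" using \<delta> by (simp add: r_def)
  define p s where "p = u x0" and "s x = t x0 x" for x
  define X where "X x = p + s x *\<^sub>R rot p" for x
  define L where "L = 2 * \<Lambda> + 2 * \<Lambda>\<^sup>2"
  have p: "norm p = 1" "p \<bullet> p = 1" using unit[of x0] by (auto simp: p_def dot_square_norm)
  have X: "u x = (p \<bullet> u x) *\<^sub>R X x" "p \<bullet> u x \<noteq> 0" "\<bar>s x\<bar> \<le> 1" if "x \<in> ball x0 r" for x
  proof -
    have "norm (x - x0) \<le> \<delta>" using that \<delta> by (simp add: r_def dist_norm norm_minus_commute)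
    note f = fo[OF this]
    show "p \<bullet> u x \<noteq> 0" "\<bar>s x\<bar> \<le> 1" using f by (auto simp: p_def s_def)
    then show "u x = (p \<bullet> u x) *\<^sub>R X x"
      unfolding X_def s_def p_def by (intro tan_angle_decomp unit) auto
  qed
  have X_nz: "X x \<noteq> 0" for x
  proof
    assume "X x = 0"
    then have "p \<bullet> X x = 0" by simp
    then show False by (simp add: X_def inner_add_right p)
  qed
  have span: "span {X x} = span {u x}" if "x \<in> ball x0 r" for x
    using span_image_scale[of "{X x}" "\<lambda>_. p \<bullet> u x"] X[OF that] by simp
  have d: "norm (y - x) \<le> \<delta>" "norm (y - x) \<le> 1" if "x \<in> ball x0 r" "y \<in> ball x0 r" for x y
  proof -
    have "dist x y \<le> dist x x0 + dist x0 y" by (rule dist_triangle)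
    then show "norm (y - x) \<le> \<delta>" "norm (y - x) \<le> 1"
      using that by (auto simp: r_def dist_norm norm_minus_commute)
  qed
  \<comment> \<open>Subtraction formula for the tangent. It transfers the expansion of
    \<open>t x y\<close> to \<open>s\<close>.\<close>
  have s_diff: "s y - s x = t x y * (1 + s x * s y)" if "x \<in> ball x0 r" "y \<in> ball x0 r" for x y
  proof -
    have i: "X x \<bullet> X y = 1 + s x * s y"
      by (simp add: X_def inner_add_left inner_add_right p inner_commute[of "rot p" p] dot_square_norm)
    have w: "wedge (X x) (X y) = s y - s x"
      by (simp add: X_def wedge.bilinear_simps wedge.add_left wedge.add_right wedge.scaleR_left
          wedge.scaleR_right wedge_rot p wedge_antisym[of "rot p" p])
    have "u x \<bullet> u y \<noteq> 0" using fo[OF d(1)[OF that]] by blast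
    then have nz: "1 + s x * s y \<noteq> 0"
      using X(1)[OF that(1)] X(1)[OF that(2)] i by (metis inner_scaleR_left inner_scaleR_right mult_zero_right)
    have "t x y = tan_angle (X x) (X y)"
      by (subst X(1)[OF that(1)], subst X(1)[OF that(2)], rule tan_angle_scaleR) (use X that in auto)
    also have "\<dots> = (s y - s x) / (1 + s x * s y)" by (simp add: tan_angle_def w i)
    finally show ?thesis using nz by simp
  qed
  have ss: "\<bar>1 + s x * s y\<bar> \<le> 2" if "x \<in> ball x0 r" "y \<in> ball x0 r" for x y
  proof -
    have "\<bar>s x * s y\<bar> \<le> 1 * 1" unfolding abs_mult using X(3) that by (intro mult_mono) auto
    then show ?thesis by linarith
  qed
  have s_lip: "\<bar>s y - s x\<bar> \<le> 2 * \<Lambda> * norm (y - x)" if "x \<in> ball x0 r" "y \<in> ball x0 r" for x y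
  proof -
    have "\<bar>s y - s x\<bar> \<le> (\<Lambda> * norm (y - x)) * 2"
      unfolding s_diff[OF that] abs_mult
      using ss[OF that] fo[OF d(1)[OF that]] by (intro mult_mono) auto
    then show ?thesis by simp
  qed
  \<comment> \<open>The factor from \<open>s_diff\<close> at \<open>y = x\<close>; replacing
    \<open>s y\<close> by \<open>s x\<close> costs a quadratic error.\<close>
  define A' where "A' x = (1 + s x * s x) *\<^sub>R A x" for x
  have s_fo: "\<bar>s y - s x - A' x (y - x)\<bar> \<le> L * norm (y - x) powr (1 + \<gamma>)"
    if xy: "x \<in> ball x0 r" "y \<in> ball x0 r" for x y
  proof -
    define h where "h = norm (y - x)"
    note f = fo[OF d(1)[OF xy], folded h_def]
    have h: "0 \<le> h" "h \<le> 1" using d(2)[OF xy] by (auto simp: h_def)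
    have hh: "h * h \<le> h powr (1 + \<gamma>)"
    proof -
      have "h powr 2 \<le> h powr (1 + \<gamma>)" using h \<gamma> by (intro powr_mono') auto
      then show ?thesis using h by (simp add: power2_eq_square)
    qed
    have "s y - s x - A' x (y - x)
        = (1 + s x * s x) * (t x y - A x (y - x)) + (t x y * s x) * (s y - s x)"
      using s_diff[OF xy] by (simp add: A'_def blinfun.bilinear_simps algebra_simps)
    also have "\<bar>\<dots>\<bar> \<le> 2 * (\<Lambda> * h powr (1 + \<gamma>)) + (\<Lambda> * h * 1) * (2 * \<Lambda> * h)"
      using f ss[OF xy(1) xy(1)] s_lip[OF xy, folded h_def] X(3)[OF xy(1)] \<Lambda> h
      by (intro order_trans[OF abs_triangle_ineq] add_mono) (auto simp only: abs_mult intro!: mult_mono)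
    also have "(\<Lambda> * h * 1) * (2 * \<Lambda> * h) = 2 * \<Lambda>\<^sup>2 * (h * h)" by (simp add: power2_eq_square)
    also have "2 * \<Lambda>\<^sup>2 * (h * h) \<le> 2 * \<Lambda>\<^sup>2 * h powr (1 + \<gamma>)" using hh by (intro mult_left_mono) auto
    finally show ?thesis by (simp add: L_def h_def algebra_simps)
  qed
  have "holder_on b (\<lambda>x. X x $ i) (ball x0 r)" for i
  proof (rule holder_on_of_first_order[OF open_ball b \<gamma>0 \<gamma>(2)])
    show "0 < L" using \<Lambda> by (simp add: L_def add_pos_nonneg)
    have ri: "\<bar>rot p $ i\<bar> \<le> 1" using component_le_norm_cart[of "rot p" i] p by simp
    have Xi: "X y $ i - X x $ i = rot p $ i * (s y - s x)" for x y
      by (simp add: X_def algebra_simps)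
    fix x y assume xy: "x \<in> ball x0 r" "y \<in> ball x0 r"
    have "\<bar>X y $ i - X x $ i\<bar> \<le> 1 * (2 * \<Lambda> * norm (y - x))"
      unfolding Xi abs_mult by (intro mult_mono ri s_lip xy) auto
    also have "\<dots> \<le> L * norm (y - x)" unfolding mult_1 by (intro mult_right_mono) (auto simp: L_def)
    finally show "\<bar>X y $ i - X x $ i\<bar> \<le> L * norm (y - x)" .
    have "X y $ i - X x $ i - (rot p $ i *\<^sub>R A' x) (y - x) = rot p $ i * (s y - s x - A' x (y - x))"
      unfolding Xi by (simp add: blinfun.scaleR_left right_diff_distrib)
    also have "\<bar>\<dots>\<bar> \<le> 1 * (L * norm (y - x) powr (1 + \<gamma>))"
      unfolding abs_mult by (intro mult_mono ri s_fo xy) auto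
    finally show "\<bar>X y $ i - X x $ i - (rot p $ i *\<^sub>R A' x) (y - x)\<bar> \<le> L * norm (y - x) powr (1 + \<gamma>)"
      by simp
  qed
  then show ?thesis using r X_nz span by blast
qed

end

section \<open>Passage to a high iterate\<close>

text \<open>The product of the derivatives along the orbit, so that invariance and determinants pass
  to iterates by plain induction.\<close>

primrec iterate_deriv ::
  "('a::real_normed_vector \<Rightarrow> 'a) \<Rightarrow> ('a \<Rightarrow> 'a \<Rightarrow>\<^sub>L 'a) \<Rightarrow> nat \<Rightarrow> 'a \<Rightarrow> 'a \<Rightarrow>\<^sub>L 'a" where
  "iterate_deriv F M 0 x = id_blinfun"
| "iterate_deriv F M (Suc n) x = M ((F ^^ n) x) o\<^sub>L iterate_deriv F M n x"

lemma taylor2_iterate: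
  fixes F :: "'a::real_normed_vector \<Rightarrow> 'a"
  assumes "taylor2 F M H K"
  shows "\<exists>H K. taylor2 (F ^^ n) (iterate_deriv F M n) H K"
proof (induction n)
  case 0
  have "norm (id_blinfun :: 'a \<Rightarrow>\<^sub>L 'a) \<le> 1" by (rule norm_blinfun_id_le)
  then have "taylor2 (F ^^ 0) (iterate_deriv F M 0) (\<lambda>_. 0) 1"
    by (auto simp: taylor2_def id_def)
  then show ?case by blast
next
  case (Suc n)
  then obtain H' K' where "taylor2 (F ^^ n) (iterate_deriv F M n) H' K'" by blast
  from taylor2_compose[OF assms this] show ?case
    by (simp add: comp_def)
qed

lemma iterate_has_derivative:
  assumes "taylor2 F M H K"
  shows "(F ^^ n has_derivative iterate_deriv F M n x) (at x)"
  using taylor2_iterate[OF assms, of n] taylor2_has_derivative by blast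

lemma funpow_left_inverse:
  fixes f g :: "'a \<Rightarrow> 'a"
  assumes "\<And>x. g (f x) = x"
  shows "(g ^^ n) ((f ^^ n) x) = x"
proof (induction n)
  case (Suc n)
  have "(g ^^ Suc n) z = (g ^^ n) (g z)" for z by (simp add: funpow_swap1)
  then show ?case by (simp add: assms Suc)
qed simp

lemma iterate_deriv_inverse:
  assumes F: "taylor2 F M H K" and G: "taylor2 G MG HG KG" and GF: "\<And>x. G (F x) = x"
  shows "iterate_deriv G MG n ((F ^^ n) x) (iterate_deriv F M n x v) = v"
proof -
  have "(\<lambda>y. (G ^^ n) ((F ^^ n) y)) = (\<lambda>y. y)" by (auto simp: funpow_left_inverse GF)
  moreover have "((\<lambda>y. (G ^^ n) ((F ^^ n) y)) has_derivative
      (\<lambda>v. iterate_deriv G MG n ((F ^^ n) x) (iterate_deriv F M n x v))) (at x)"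
    by (rule has_derivative_compose[OF iterate_has_derivative[OF F] iterate_has_derivative[OF G]])
  ultimately have "((\<lambda>y. y) has_derivative
      (\<lambda>v. iterate_deriv G MG n ((F ^^ n) x) (iterate_deriv F M n x v))) (at x)" by simp
  then have "(\<lambda>v. iterate_deriv G MG n ((F ^^ n) x) (iterate_deriv F M n x v)) = (\<lambda>v. v)"
    using has_derivative_unique has_derivative_ident by blast
  then show ?thesis by metis
qed

lemma wedge_cramer: "wedge a b *\<^sub>R v = wedge v b *\<^sub>R a + wedge a v *\<^sub>R b"
  unfolding vec2_eq_iff by (simp add: wedge_def algebra_simps)

locale area_preserving_hyperbolic =
  fixes F G :: "real^2 \<Rightarrow> real^2" and M MG H HG and K KG C \<mu> :: real
    and u s :: "real^2 \<Rightarrow> real^2" and \<sigma> :: "real^2 \<Rightarrow> real"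
  assumes F_taylor: "taylor2 F M H K" and G_taylor: "taylor2 G MG HG KG"
    and G_F: "G (F x) = x" and F_G: "F (G x) = x"
    and wedge_M: "wedge (M x v) (M x w) = \<sigma> x * wedge v w"
    and abs_\<sigma>: "\<bar>\<sigma> x\<bar> = 1"
    and unit_u: "norm (u x) = 1" and unit_s: "norm (s x) = 1"
    and invariant: "\<exists>c. M x (u x) = c *\<^sub>R u (F x)"
    and C: "0 < C" and \<mu>: "0 < \<mu>" "\<mu> < 1"
    and contract_u: "norm (iterate_deriv G MG n x (u x)) \<le> C * \<mu> ^ n"
    and contract_s: "norm (iterate_deriv F M n x (s x)) \<le> C * \<mu> ^ n"
begin

abbreviation D :: "nat \<Rightarrow> real^2 \<Rightarrow> ((real^2) \<Rightarrow>\<^sub>L (real^2))" where "D \<equiv> iterate_deriv F M"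
abbreviation D' :: "nat \<Rightarrow> real^2 \<Rightarrow> ((real^2) \<Rightarrow>\<^sub>L (real^2))" where "D' \<equiv> iterate_deriv G MG"

section \<open>Expansion, angles and norms for iterated derivatives\<close>

lemma iterate_wedge:
  "\<exists>\<sigma>'. \<forall>x. \<bar>\<sigma>' x\<bar> = 1 \<and> (\<forall>v w. wedge (D n x v) (D n x w) = \<sigma>' x * wedge v w)"
proof (induction n)
  case 0
  show ?case by (intro exI[of _ "\<lambda>_. 1"]) simp
next
  case (Suc n)
  then obtain \<sigma>' where "\<And>x. \<bar>\<sigma>' x\<bar> = 1" "\<And>x v w. wedge (D n x v) (D n x w) = \<sigma>' x * wedge v w"
    by blast
  then show ?case
    by (intro exI[of _ "\<lambda>x. \<sigma> ((F ^^ n) x) * \<sigma>' x"]) (simp add: wedge_M abs_mult abs_\<sigma>)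
qed

lemma iterate_invariant: "\<exists>c. \<forall>x. D n x (u x) = c x *\<^sub>R u ((F ^^ n) x)"
proof (induction n)
  case 0
  show ?case by (intro exI[of _ "\<lambda>_. 1"]) simp
next
  case (Suc n)
  then obtain c' where c': "\<And>x. D n x (u x) = c' x *\<^sub>R u ((F ^^ n) x)" by blast
  obtain c where c: "\<And>x. M x (u x) = c x *\<^sub>R u (F x)" using invariant by metis
  show ?case
    by (intro exI[of _ "\<lambda>x. c' x * c ((F ^^ n) x)"]) (simp add: c' c blinfun.scaleR_right)
qed

text \<open>Going forward and back along the orbit is the identity, and the way back contracts the
  unit vector by \<open>C * \<mu> ^ n\<close>; the way forward must compensate.\<close>

lemma expansion_ge:
  assumes "D n x (u x) = c *\<^sub>R u ((F ^^ n) x)"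
  shows "1 \<le> \<bar>c\<bar> * (C * \<mu> ^ n)"
proof -
  have "1 = norm (D' n ((F ^^ n) x) (D n x (u x)))"
    by (simp add: iterate_deriv_inverse[OF F_taylor G_taylor G_F] unit_u)
  also have "\<dots> = \<bar>c\<bar> * norm (D' n ((F ^^ n) x) (u ((F ^^ n) x)))"
    by (simp add: assms blinfun.scaleR_right)
  also have "\<dots> \<le> \<bar>c\<bar> * (C * \<mu> ^ n)" by (intro mult_left_mono contract_u) simp
  finally show ?thesis .
qed

lemma ex_small_contraction:
  assumes "0 < Z"
  shows "\<exists>n. C * \<mu> ^ n * Z \<le> 1"
proof -
  obtain n where "\<mu> ^ n < 1 / (C * Z)"
    using real_arch_pow_inv[of "1 / (C * Z)" \<mu>] C \<mu> assms by auto
  then show ?thesis using C assms by (intro exI[of _ n]) (simp add: field_simps)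
qed

text \<open>If \<open>u x\<close> and \<open>s x\<close> were almost parallel, a fixed iterate could not expand one of them and
  contract the other.\<close>

lemma uniformly_transverse: "\<exists>\<eta>>0. \<forall>x. \<eta> \<le> \<bar>wedge (u x) (s x)\<bar>"
proof -
  \<comment> \<open>This iterate expands \<open>u x\<close> at least by 2 and contracts
    \<open>s x\<close> at least to \<open>1/2\<close>, with a derivative bounded uniformly in
    \<open>x\<close>.\<close>
  obtain n where n: "C * \<mu> ^ n * 2 \<le> 1" using ex_small_contraction[of 2] by auto
  obtain H' K' where t: "taylor2 (F ^^ n) (D n) H' K'" using taylor2_iterate[OF F_taylor] by blast
  have "1 \<le> \<bar>wedge (u x) (s x)\<bar> * K'" for x
  proof -
    obtain c where c: "D n x (u x) = c *\<^sub>R u ((F ^^ n) x)" using iterate_invariant by blast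
    have "1 \<le> \<bar>c\<bar> * (C * \<mu> ^ n)" by (rule expansion_ge[OF c])
    also have "\<dots> \<le> \<bar>c\<bar> * (1 / 2)" using n by (intro mult_left_mono) auto
    finally have "2 \<le> norm (D n x (u x))" by (simp add: c unit_u)
    also have "D n x (u x) = D n x ((s x \<bullet> u x) *\<^sub>R s x + wedge (s x) (u x) *\<^sub>R rot (s x))"
      using unit_decomp[OF unit_s, of "u x" x] by simp
    also have "\<dots> = (s x \<bullet> u x) *\<^sub>R D n x (s x) + wedge (s x) (u x) *\<^sub>R D n x (rot (s x))"
      by (simp add: blinfun.bilinear_simps)
    also have "norm \<dots> \<le> 1 * (C * \<mu> ^ n) + \<bar>wedge (u x) (s x)\<bar> * (K' * 1)"
    proof (intro order_trans[OF norm_triangle_ineq] add_mono)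
      have "\<bar>s x \<bullet> u x\<bar> \<le> 1" using Cauchy_Schwarz_ineq2[of "s x" "u x"] by (simp add: unit_u unit_s)
      then show "norm ((s x \<bullet> u x) *\<^sub>R D n x (s x)) \<le> 1 * (C * \<mu> ^ n)"
        unfolding norm_scaleR by (intro mult_mono contract_s) auto
      have "norm (D n x (rot (s x))) \<le> K' * 1"
        by (intro norm_blinfun_apply_mono taylor2D(2)[OF t]) (simp add: unit_s)
      then show "norm (wedge (s x) (u x) *\<^sub>R D n x (rot (s x))) \<le> \<bar>wedge (u x) (s x)\<bar> * (K' * 1)"
        unfolding norm_scaleR wedge_antisym[of "s x"] by (simp add: mult_left_mono)
    qed
    finally show ?thesis using n by linarith
  qed
  moreover from this[of 0] have "0 < K'"
    using taylor2D(1)[OF t] by (smt (verit) mult_nonneg_nonpos abs_ge_zero)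
  ultimately show ?thesis by (intro exI[of _ "1 / K'"]) (simp add: field_simps)
qed

text \<open>The coefficients of \<open>v\<close> in the basis \<open>u x\<close>, \<open>s x\<close>
  are at most \<open>norm v / \<eta>\<close>; one basis vector is stretched by
  \<open>\<bar>c\<bar>\<close>, the other at most by \<open>C\<close>. The constant is independent
  of \<open>n\<close>, so it can be fixed before the iterate is chosen.\<close>

lemma iterate_norm_le:
  "\<exists>C\<^sub>0\<ge>1. \<forall>n x c. D n x (u x) = c *\<^sub>R u ((F ^^ n) x) \<longrightarrow> 1 \<le> \<bar>c\<bar> \<longrightarrow> norm (D n x) \<le> C\<^sub>0 * \<bar>c\<bar>"
proof -
  obtain \<eta> where \<eta>: "0 < \<eta>" "\<And>x. \<eta> \<le> \<bar>wedge (u x) (s x)\<bar>" using uniformly_transverse by blast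
  have "norm (D n x) \<le> max 1 ((1 + C) / \<eta>) * \<bar>c\<bar>"
    if c: "D n x (u x) = c *\<^sub>R u ((F ^^ n) x)" and c1: "1 \<le> \<bar>c\<bar>" for n x c
  proof (rule norm_blinfun_bound)
    fix v
    have "\<mu> ^ n \<le> 1" using \<mu> by (simp add: power_le_one)
    then have Cn: "C * \<mu> ^ n \<le> C" using C by (simp add: mult_left_le)
    have "\<eta> * norm (D n x v) \<le> \<bar>wedge (u x) (s x)\<bar> * norm (D n x v)"
      using \<eta> by (intro mult_right_mono) auto
    also have "\<dots> = norm (D n x (wedge (u x) (s x) *\<^sub>R v))" by (simp add: blinfun.scaleR_right)
    also have "\<dots> = norm (wedge v (s x) *\<^sub>R D n x (u x) + wedge (u x) v *\<^sub>R D n x (s x))"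
      unfolding wedge_cramer[of "u x" "s x" v] by (simp add: blinfun.bilinear_simps)
    also have "\<dots> \<le> norm v * \<bar>c\<bar> + norm v * C"
      using abs_wedge_le[of v "s x"] abs_wedge_le[of "u x" v] Cn contract_s[of n x]
      by (intro order_trans[OF norm_triangle_ineq] add_mono)
        (auto simp: unit_u unit_s c abs_mult intro!: mult_mono)
    also have "\<dots> \<le> norm v * \<bar>c\<bar> + norm v * (C * \<bar>c\<bar>)"
      using C c1 by (intro add_left_mono mult_left_mono) auto
    finally have "norm (D n x v) \<le> (1 + C) / \<eta> * \<bar>c\<bar> * norm v"
      using \<eta> by (simp add: field_simps)
    also have "\<dots> \<le> max 1 ((1 + C) / \<eta>) * \<bar>c\<bar> * norm v" by (intro mult_right_mono) auto
    finally show "norm (D n x v) \<le> max 1 ((1 + C) / \<eta>) * \<bar>c\<bar> * norm v" .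
  qed auto
  then show ?thesis by (intro exI[of _ "max 1 ((1 + C) / \<eta>)"]) auto
qed

text \<open>An invertible linear map of the plane with determinant \<open>1\<close> or \<open>- 1\<close> has the same norm as its inverse.\<close>

lemma inverse_norm_le: "norm (D' n x) \<le> norm (D n ((G ^^ n) x))"
proof (rule norm_blinfun_bound)
  fix v
  define z where "z = D' n x v"
  define y where "y = (G ^^ n) x"
  have v: "D n y z = v"
    unfolding z_def y_def by (rule iterate_deriv_inverse[OF G_taylor F_taylor F_G])
  obtain \<sigma>' where \<sigma>': "\<bar>\<sigma>'\<bar> = 1" "\<And>v w. wedge (D n y v) (D n y w) = \<sigma>' * wedge v w"
    using iterate_wedge by metis
  \<comment> \<open>\<open>rot z\<close> is orthogonal to \<open>z\<close> and of the same length,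
    so their wedge is the squared norm.\<close>
  have "norm z * norm z = \<bar>wedge (D n y z) (D n y (rot z))\<bar>"
    unfolding \<sigma>' by (simp add: wedge_rot abs_mult \<sigma>' power2_eq_square)
  also have "\<dots> \<le> norm v * (norm (D n y) * norm z)"
    unfolding v using norm_blinfun[of "D n y" "rot z"]
    by (intro order_trans[OF abs_wedge_le] mult_left_mono) auto
  finally have "norm z * norm z \<le> norm z * (norm (D n y) * norm v)" by (simp add: mult_ac)
  then show "norm (D' n x v) \<le> norm (D n y) * norm v"
    by (cases "z = 0") (auto simp: z_def[symmetric])
qed simp

lemma invariant_line_field_holder:
  assumes b: "b < 2"
  shows "\<exists>r>0. \<exists>X. (\<forall>i. holder_on b (\<lambda>x. X x $ i) (ball x0 r)) \<and>
     (\<forall>x\<in>ball x0 r. X x \<noteq> 0 \<and> span {X x} = span {u x})"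
proof -
  \<comment> \<open>The entry \<open>1/2\<close> keeps the exponent positive when \<open>b\<close>
    is small; \<open>b < 2\<close> keeps it below 1.\<close>
  define \<gamma> where "\<gamma> = max (1/2) (b - 1)"
  have g: "0 < \<gamma>" "\<gamma> < 1" "b \<le> 1 + \<gamma>" using b by (auto simp: \<gamma>_def)
  obtain C\<^sub>0 where C\<^sub>0: "1 \<le> C\<^sub>0"
    and norm_le: "\<And>n x c. D n x (u x) = c *\<^sub>R u ((F ^^ n) x) \<Longrightarrow> 1 \<le> \<bar>c\<bar> \<Longrightarrow> norm (D n x) \<le> C\<^sub>0 * \<bar>c\<bar>"
    using iterate_norm_le by blast
  \<comment> \<open>An expansion factor of at least \<open>Z\<close> fulfils both parts of
    \<open>gap\<close>; the iterate \<open>n\<close> is then chosen so long that every factor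
    reaches \<open>Z\<close>.\<close>
  define Z where "Z = max (4 * C\<^sub>0) ((8 * C\<^sub>0\<^sup>2) powr (1 / (1 - \<gamma>)))"
  have Z: "4 * C\<^sub>0 \<le> Z" "0 < Z" using C\<^sub>0 by (auto simp: Z_def)
  obtain n where n: "C * \<mu> ^ n * Z \<le> 1" using ex_small_contraction[OF Z(2)] by blast
  obtain c where c: "\<And>x. D n x (u x) = c x *\<^sub>R u ((F ^^ n) x)" using iterate_invariant by blast
  have cZ: "Z \<le> \<bar>c x\<bar>" for x
  proof -
    have "Z * 1 \<le> Z * (\<bar>c x\<bar> * (C * \<mu> ^ n))"
      using Z by (intro mult_left_mono expansion_ge[OF c]) auto
    also have "\<dots> = \<bar>c x\<bar> * (C * \<mu> ^ n * Z)" by simp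
    also have "\<dots> \<le> \<bar>c x\<bar> * 1" by (intro mult_left_mono n) auto
    finally show ?thesis by simp
  qed
  obtain \<sigma>' where \<sigma>': "\<And>x. \<bar>\<sigma>' x\<bar> = 1" "\<And>x v w. wedge (D n x v) (D n x w) = \<sigma>' x * wedge v w"
    using iterate_wedge by metis
  obtain H1 K1 where t1: "taylor2 (F ^^ n) (D n) H1 K1" using taylor2_iterate[OF F_taylor] by blast
  obtain H2 K2 where t2: "taylor2 (G ^^ n) (D' n) H2 K2" using taylor2_iterate[OF G_taylor] by blast
  define L where "L = max 1 (max K1 K2)"
  interpret expanding_line_field "F ^^ n" "G ^^ n" "D n" "D' n" H1 H2 L C\<^sub>0 \<gamma> u c \<sigma>'
  proof
    show "taylor2 (F ^^ n) (D n) H1 L" "taylor2 (G ^^ n) (D' n) H2 L"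
      using taylor2_mono[OF t1] taylor2_mono[OF t2] by (auto simp: L_def)
    show "(F ^^ n) ((G ^^ n) x) = x" for x by (rule funpow_left_inverse) (rule F_G)
    fix x
    show "norm (D' n x) \<le> C\<^sub>0 * \<bar>c ((G ^^ n) x)\<bar>"
      using cZ[of "(G ^^ n) x"] Z C\<^sub>0 by (intro order_trans[OF inverse_norm_le] norm_le c) auto
    show "4 * C\<^sub>0 \<le> \<bar>c x\<bar>" using cZ[of x] Z by linarith
    have "8 * C\<^sub>0\<^sup>2 = ((8 * C\<^sub>0\<^sup>2) powr (1 / (1 - \<gamma>))) powr (1 - \<gamma>)"
      using C\<^sub>0 g by (simp add: powr_powr)
    also have "\<dots> \<le> \<bar>c x\<bar> powr (1 - \<gamma>)"
      using cZ[of x] g by (intro powr_mono2) (auto simp: Z_def)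
    finally show "8 * C\<^sub>0\<^sup>2 \<le> \<bar>c x\<bar> powr (1 - \<gamma>)" .
  qed (use unit_u c \<sigma>' C\<^sub>0 g in \<open>auto simp: L_def\<close>)
  show ?thesis by (rule local_holder_generator[OF g(3) g(1)])
qed

end

section \<open>Smooth lifts of torus maps\<close>

text \<open>Assembled from the partial derivatives, so that it is a bounded linear map without side
  conditions and its norm is controlled by theirs.\<close>

definition gradient :: "('a::euclidean_space \<Rightarrow> 'b::real_normed_vector) \<Rightarrow> 'a \<Rightarrow> 'a \<Rightarrow>\<^sub>L 'b" where
  "gradient f x = (\<Sum>e\<in>Basis. blinfun_scaleR_left (frechet_derivative f (at x) e) o\<^sub>L blinfun_inner_left e)"

lemma gradient_apply: "gradient f x v = (\<Sum>e\<in>Basis. (v \<bullet> e) *\<^sub>R frechet_derivative f (at x) e)"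
  by (simp add: gradient_def blinfun.sum_left)

lemma has_derivative_gradient:
  assumes "f differentiable at x"
  shows "(f has_derivative gradient f x) (at x)"
proof -
  have d: "(f has_derivative frechet_derivative f (at x)) (at x)"
    using assms unfolding frechet_derivative_works .
  interpret l: linear "frechet_derivative f (at x)"
    using d by (rule has_derivative_linear)
  have "gradient f x v = frechet_derivative f (at x) v" for v
    unfolding gradient_apply l.scale[symmetric] l.sum[symmetric] euclidean_representation ..
  then have "blinfun_apply (gradient f x) = frechet_derivative f (at x)" by (rule ext)
  then show ?thesis using d by simp
qed

lemma norm_sum_compose_inner_le:
  fixes z :: "'a::euclidean_space \<Rightarrow> 'b::real_normed_vector"
  shows "norm (\<Sum>e\<in>Basis. blinfun_scaleR_left (z e) o\<^sub>L blinfun_inner_left e) \<le> (\<Sum>e\<in>Basis. norm (z e))"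
proof (rule norm_blinfun_bound)
  fix v :: 'a
  have "norm ((\<Sum>e\<in>Basis. blinfun_scaleR_left (z e) o\<^sub>L blinfun_inner_left e) v) \<le> (\<Sum>e\<in>Basis. norm ((v \<bullet> e) *\<^sub>R z e))"
    using norm_sum[of "\<lambda>e. (v \<bullet> e) *\<^sub>R z e" Basis] by (simp add: blinfun.sum_left)
  also have "\<dots> \<le> (\<Sum>e\<in>Basis. norm (z e) * norm v)"
    by (intro sum_mono) (simp add: mult.commute[of _ "norm v"] mult_right_mono Basis_le_norm)
  finally show "norm ((\<Sum>e\<in>Basis. blinfun_scaleR_left (z e) o\<^sub>L blinfun_inner_left e) v) \<le> (\<Sum>e\<in>Basis. norm (z e)) * norm v"
    by (simp add: sum_distrib_right)
qed (simp add: sum_nonneg)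

lemma gradient_diff:
  "gradient f y - gradient f x =
    (\<Sum>e\<in>Basis. blinfun_scaleR_left (frechet_derivative f (at y) e - frechet_derivative f (at x) e) o\<^sub>L blinfun_inner_left e)"
  by (rule blinfun_eqI) (simp add: gradient_def blinfun.sum_left blinfun.diff_left sum_subtractf scaleR_diff_right)

lemma lipschitz_if_partials_bounded:
  fixes f :: "'a::euclidean_space \<Rightarrow> 'b::real_normed_vector"
  assumes "\<And>x. f differentiable at x"
    and "\<And>e x. e \<in> Basis \<Longrightarrow> norm (frechet_derivative f (at x) e) \<le> B"
  shows "norm (f y - f x) \<le> real DIM('a) * B * norm (y - x)"
proof (rule differentiable_bound[where S = UNIV and f' = "\<lambda>x. gradient f x"])
  fix x
  have "norm (gradient f x) \<le> (\<Sum>e\<in>(Basis::'a set). B)"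
    unfolding gradient_def by (intro order_trans[OF norm_sum_compose_inner_le] sum_mono assms)
  then show "onorm (gradient f x) \<le> real DIM('a) * B" by (simp add: norm_blinfun.rep_eq)
  show "(f has_derivative gradient f x) (at x within UNIV)"
    using has_derivative_gradient[OF assms(1)] by simp
qed auto

lemma linear_approximation_if_partials_lipschitz:
  fixes f :: "'a::euclidean_space \<Rightarrow> 'b::real_normed_vector"
  assumes d: "\<And>x. f differentiable at x"
    and lip: "\<And>e x y. e \<in> Basis \<Longrightarrow>
      norm (frechet_derivative f (at y) e - frechet_derivative f (at x) e) \<le> L * norm (y - x)"
  shows "norm (gradient f y - gradient f x) \<le> real DIM('a) * L * norm (y - x)"
    and "norm (f y - f x - gradient f x (y - x)) \<le> real DIM('a) * L * (norm (y - x))\<^sup>2"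
proof -
  have g: "norm (gradient f y - gradient f x) \<le> real DIM('a) * L * norm (y - x)" for x y
  proof -
    have "norm (gradient f y - gradient f x) \<le> (\<Sum>e\<in>(Basis::'a set). L * norm (y - x))"
      unfolding gradient_diff by (intro order_trans[OF norm_sum_compose_inner_le] sum_mono lip)
    then show ?thesis by simp
  qed
  then show "norm (gradient f y - gradient f x) \<le> real DIM('a) * L * norm (y - x)" .
  have L: "0 \<le> L"
  proof -
    obtain e :: 'a where e: "e \<in> Basis" using nonempty_Basis by blast
    show ?thesis
      using order_trans[OF norm_ge_zero lip[OF e, of e 0]] e by simp
  qed
  have "norm (f y - f x - gradient f x (y - x)) \<le> norm (y - x) * (real DIM('a) * L * norm (y - x))"
  proof (rule differentiable_bound_linearization[where S = "cball x (norm (y - x))" and f' = "\<lambda>x. gradient f x"])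
    show "x + t *\<^sub>R (y - x) \<in> cball x (norm (y - x))" if "t \<in> {0..1}" for t
      using that by (auto simp: dist_norm mult_left_le_one_le)
    show "(f has_derivative gradient f z) (at z within cball x (norm (y - x)))" for z
      using has_derivative_gradient[OF d] has_derivative_at_withinI by blast
    fix z assume z: "z \<in> cball x (norm (y - x))"
    have "onorm (blinfun_apply (gradient f z) - blinfun_apply (gradient f x)) = norm (gradient f z - gradient f x)"
      unfolding norm_blinfun.rep_eq by (rule arg_cong[where f = onorm]) (simp add: blinfun.diff_left fun_eq_iff)
    also have "\<dots> \<le> real DIM('a) * L * norm (z - x)" by (rule g)
    also have "\<dots> \<le> real DIM('a) * L * norm (y - x)"
      using z L by (intro mult_left_mono) (auto simp: dist_norm norm_minus_commute)
    finally show "onorm (blinfun_apply (gradient f z) - blinfun_apply (gradient f x)) \<le> real DIM('a) * L * norm (y - x)" .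
  qed simp
  then show "norm (f y - f x - gradient f x (y - x)) \<le> real DIM('a) * L * (norm (y - x))\<^sup>2"
    by (simp add: power2_eq_square mult_ac)
qed

lemma frechet_derivative_partials: "frechet_derivative (partials vs f) (at x) e = partials (e # vs) f x"
  by simp

text \<open>The quadratic remainder of the first derivative needs Lipschitz second partial
  derivatives, hence bounds up to order 3. Order 0 is excluded because lifts are unbounded.\<close>

lemma taylor2_of_bounded_partials:
  fixes f :: "'a::euclidean_space \<Rightarrow> 'b::real_normed_vector"
  assumes d: "\<And>vs x. set vs \<subseteq> Basis \<Longrightarrow> partials vs f differentiable at x"
    and bnd: "\<And>vs. set vs \<subseteq> Basis \<Longrightarrow> vs \<noteq> [] \<Longrightarrow> \<exists>B. \<forall>x. norm (partials vs f x) \<le> B"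
  shows "\<exists>H K. taylor2 f (gradient f) H K"
proof -
  define V :: "'a list set" where "V = {vs. set vs \<subseteq> Basis \<and> length vs \<le> 3}"
  have fin: "finite V" unfolding V_def by (rule finite_lists_length_le) simp
  define bd where "bd vs = (if vs = [] then 0 else SOME B. \<forall>x. norm (partials vs f x) \<le> B)" for vs
  have bd: "norm (partials vs f x) \<le> bd vs" if "set vs \<subseteq> Basis" "vs \<noteq> []" for vs x
    using someI_ex[OF bnd[OF that]] that(2) by (simp add: bd_def)
  define B where "B = (\<Sum>vs\<in>V. \<bar>bd vs\<bar>)"
  have B: "norm (partials vs f x) \<le> B" if "set vs \<subseteq> Basis" "vs \<noteq> []" "length vs \<le> 3" for vs x
  proof -
    have "vs \<in> V" using that by (simp add: V_def)
    then have "\<bar>bd vs\<bar> \<le> B" unfolding B_def using fin by (intro member_le_sum) auto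
    then show ?thesis using bd[OF that(1,2), of x] by linarith
  qed
  have B0: "0 \<le> B" by (simp add: B_def sum_nonneg)
  define N where "N = real DIM('a)"
  have N: "1 \<le> N" by (simp add: N_def DIM_positive Suc_leI)
  have lip: "norm (partials vs f y - partials vs f x) \<le> N * B * norm (y - x)"
    if "set vs \<subseteq> Basis" "length vs \<le> 2" for vs x y
    unfolding N_def
    by (rule lipschitz_if_partials_bounded[OF d[OF that(1)]])
       (use that B in \<open>auto simp: frechet_derivative_partials simp del: partials.simps\<close>)
  have gradient_norm: "norm (gradient (partials vs f) x) \<le> N * B" if "set vs \<subseteq> Basis" "length vs \<le> 2" for vs x
  proof -
    have "norm (gradient (partials vs f) x) \<le> (\<Sum>e\<in>(Basis::'a set). B)"
      unfolding gradient_def frechet_derivative_partials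
      using that by (intro order_trans[OF norm_sum_compose_inner_le] sum_mono B) auto
    then show ?thesis by (simp add: N_def)
  qed
  have lin: "norm (gradient (partials vs f) y - gradient (partials vs f) x) \<le> N * (N * B) * norm (y - x)"
    "norm (partials vs f y - partials vs f x - gradient (partials vs f) x (y - x)) \<le> N * (N * B) * (norm (y - x))\<^sup>2"
    if "set vs \<subseteq> Basis" "length vs \<le> 1" for vs x y
    unfolding N_def using that
    by (intro linear_approximation_if_partials_lipschitz[OF d[OF that(1)]];
        force simp: frechet_derivative_partials N_def[symmetric] simp del: partials.simps intro!: lip)+
  define T where "T e = Blinfun (\<lambda>z::'b. blinfun_scaleR_left z o\<^sub>L blinfun_inner_left e)"
    for e :: 'a
  have T: "T e z = blinfun_scaleR_left z o\<^sub>L blinfun_inner_left e" for e and z :: 'b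
  proof -
    have "bounded_linear (\<lambda>z::'b. blinfun_scaleR_left z o\<^sub>L blinfun_inner_left e)"
      by (intro bounded_linear_compose[OF bounded_bilinear.bounded_linear_left[OF bounded_bilinear_blinfun_compose]]
          bounded_linear_blinfun_scaleR_left)
    then show ?thesis by (simp add: T_def bounded_linear_Blinfun_apply)
  qed
  define H where "H x = (\<Sum>e\<in>Basis. T e o\<^sub>L gradient (partials [e] f) x)" for x
  have H: "H x w = (\<Sum>e\<in>Basis. blinfun_scaleR_left (gradient (partials [e] f) x w) o\<^sub>L blinfun_inner_left e)" for x w
    by (simp add: H_def blinfun.sum_left T)
  define K where "K = N * (N * B) + N * (N * (N * B))"
  have K: "N * B \<le> K" "N * (N * B) \<le> K" "N * (N * (N * B)) \<le> K" "0 \<le> K"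
  proof -
    have "0 \<le> N * (N * B)" "0 \<le> N * (N * (N * B))" using N B0 by auto
    moreover have "1 * (N * B) \<le> N * (N * B)" using N B0 by (intro mult_right_mono) auto
    ultimately show "N * B \<le> K" "N * (N * B) \<le> K" "N * (N * (N * B)) \<le> K" "0 \<le> K" unfolding K_def by linarith+
  qed
  have "taylor2 f (gradient f) H K"
    unfolding taylor2_def
  proof (intro conjI allI)
    show "0 \<le> K" by (rule K)
    fix x
    show "norm (gradient f x) \<le> K" using gradient_norm[of "[]" x] K by simp
    show "norm (H x) \<le> K"
    proof (rule order_trans[OF norm_blinfun_bound K(2)])
      fix w
      have "norm (H x w) \<le> (\<Sum>e\<in>(Basis::'a set). N * B * norm w)"
        unfolding H
        by (intro order_trans[OF norm_sum_compose_inner_le] sum_mono norm_blinfun_apply_mono gradient_norm) auto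
      then show "norm (H x w) \<le> N * (N * B) * norm w" by (simp add: N_def mult.assoc)
    qed (use N B0 in auto)
    fix y
    show "norm (f y - f x) \<le> K * norm (y - x)"
      using lip[of "[]" y x] mult_right_mono[OF K(1), of "norm (y - x)"] by simp
    show "norm (gradient f y - gradient f x) \<le> K * norm (y - x)"
      using lin(1)[of "[]" y x] mult_right_mono[OF K(2), of "norm (y - x)"] by simp
    show "norm (f y - f x - gradient f x (y - x)) \<le> K * (norm (y - x))\<^sup>2"
      using lin(2)[of "[]" y x] mult_right_mono[OF K(2), of "(norm (y - x))\<^sup>2"] by simp
    have "gradient f y - gradient f x - H x (y - x)
       = (\<Sum>e\<in>Basis. blinfun_scaleR_left (partials [e] f y - partials [e] f x - gradient (partials [e] f) x (y - x))
            o\<^sub>L blinfun_inner_left e)"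
      unfolding H gradient_diff
      by (rule blinfun_eqI) (simp add: blinfun.sum_left blinfun.diff_left sum_subtractf scaleR_diff_right)
    also have "norm \<dots> \<le> (\<Sum>e\<in>(Basis::'a set). N * (N * B) * (norm (y - x))\<^sup>2)"
      by (intro order_trans[OF norm_sum_compose_inner_le] sum_mono lin) auto
    also have "\<dots> = N * (N * (N * B)) * (norm (y - x))\<^sup>2" by (simp add: N_def)
    also have "\<dots> \<le> K * (norm (y - x))\<^sup>2" using K by (intro mult_right_mono) auto
    finally show "norm (gradient f y - gradient f x - H x (y - x)) \<le> K * (norm (y - x))\<^sup>2" .
  qed
  then show ?thesis by blast
qed

section \<open>The lattice, periodic functions and lifts\<close>

definition even_lattice :: "(real^2) set" where
  "even_lattice = {m. \<forall>i. \<exists>k::int. m $ i = 2 * of_int k}"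

lemma torus_of_eq_iff_lattice: "torus_of x = torus_of y \<longleftrightarrow> x - y \<in> even_lattice"
  by (simp add: torus_of_eq_iff torus_rel_def even_lattice_def)

lemma torus_of_add_lattice: "m \<in> even_lattice \<Longrightarrow> torus_of (x + m) = torus_of x"
  by (simp add: torus_of_eq_iff_lattice)

text \<open>Each coordinate has a discrete range on a connected space. This is how ambiguities
  between lifts are shown to be constant.\<close>

lemma continuous_lattice_valued_constant:
  fixes h :: "real^2 \<Rightarrow> real^2"
  assumes cont: "continuous_on UNIV h" and lat: "\<And>x. h x \<in> even_lattice"
  shows "h x = h y"
proof (rule vec_eq_iff[THEN iffD2], rule allI)
  fix i
  have "(\<lambda>x. h x $ i) constant_on UNIV"
  proof (rule continuous_discrete_range_constant)
    show "continuous_on UNIV (\<lambda>x. h x $ i)" by (intro continuous_on_component cont)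
    fix x
    show "\<exists>e>0. \<forall>y. y \<in> UNIV \<and> h y $ i \<noteq> h x $ i \<longrightarrow> e \<le> norm (h y $ i - h x $ i)"
    proof (intro exI[of _ 1] conjI allI impI)
      fix y assume ne: "y \<in> UNIV \<and> h y $ i \<noteq> h x $ i"
      obtain k l :: int where kl: "h y $ i = 2 * of_int k" "h x $ i = 2 * of_int l"
        using lat[of y] lat[of x] unfolding even_lattice_def by blast
      then have "1 \<le> \<bar>k - l\<bar>" using ne by auto
      then have "1 \<le> real_of_int \<bar>k - l\<bar>" by linarith
      then show "1 \<le> norm (h y $ i - h x $ i)" using kl by simp
    qed simp
  qed (rule connected_UNIV)
  then show "h x $ i = h y $ i" unfolding constant_on_def by auto
qed

lemma lattice_reduction: "\<exists>m\<in>even_lattice. x + m \<in> cbox (- 1) 1"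
proof -
  define m :: "real^2" where "m = (\<chi> i. 2 * of_int (- round (x $ i / 2)))"
  have "m \<in> even_lattice" unfolding even_lattice_def m_def mem_Collect_eq vec_lambda_beta by blast
  moreover have "x + m \<in> cbox (- 1) 1"
  proof -
    have "\<bar>of_int (round (x $ i / 2)) - x $ i / 2\<bar> \<le> 1 / 2" for i by (rule of_int_round_abs_le)
    then have "- 1 \<le> (x + m) $ i \<and> (x + m) $ i \<le> 1" for i
      using abs_le_iff[of "of_int (round (x $ i / 2)) - x $ i / 2" "1/2"] by (simp add: m_def)
    then show ?thesis by (simp add: mem_box_cart)
  qed
  ultimately show ?thesis by blast
qed

lemma periodic_continuous_bounded:
  fixes g :: "real^2 \<Rightarrow> 'b::real_normed_vector"
  assumes cont: "continuous_on UNIV g" and per: "\<And>x m. m \<in> even_lattice \<Longrightarrow> g (x + m) = g x"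
  shows "\<exists>B. \<forall>x. norm (g x) \<le> B"
proof -
  have "compact (g ` cbox (- 1) 1)"
    by (intro compact_continuous_image continuous_on_subset[OF cont] compact_cbox) simp
  then obtain B where B: "\<And>x. x \<in> cbox (- 1) 1 \<Longrightarrow> norm (g x) \<le> B"
    using compact_imp_bounded bounded_iff by (metis imageI)
  have "norm (g x) \<le> B" for x
    using lattice_reduction[of x] B per by metis
  then show ?thesis by blast
qed

lemma frechet_derivative_shift:
  assumes "f differentiable at x" and shift: "\<And>y. f (y + m) = f y + c"
  shows "frechet_derivative f (at (x + m)) = frechet_derivative f (at x)"
proof -
  have d: "(f has_derivative frechet_derivative f (at x)) (at ((x + m) + - m))"
    using assms(1)[unfolded frechet_derivative_works] by simp
  have "((\<lambda>y. y + - m) has_derivative (\<lambda>v. v)) (at (x + m))"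
    by (auto intro!: derivative_eq_intros)
  from has_derivative_compose[OF this d]
  have "((\<lambda>y. f (y + - m) + c) has_derivative frechet_derivative f (at x)) (at (x + m))"
    by (intro has_derivative_add_const) simp
  moreover have "(\<lambda>y. f (y + - m) + c) = f"
    unfolding shift[symmetric] by (simp add: fun_eq_iff)
  ultimately have "(f has_derivative frechet_derivative f (at x)) (at (x + m))" by simp
  then show ?thesis by (rule frechet_derivative_at[symmetric])
qed

lemma smooth_partials_differentiable:
  assumes "smooth f" "set vs \<subseteq> Basis"
  shows "partials vs f differentiable at x"
  using assms(1)[unfolded smooth_def times_differentiable_on_def, rule_format, of vs "Suc (length vs)" x]
    assms(2) by simp

lemma torus_lift_shift:
  assumes F: "torus_lift \<phi> F" and cont: "continuous_on UNIV F" and m: "m \<in> even_lattice"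
  shows "\<exists>c. \<forall>x. F (x + m) = F x + c"
proof -
  have "F (x + m) - F x = F (y + m) - F y" for x y
  proof (rule continuous_lattice_valued_constant[where h = "\<lambda>x. F (x + m) - F x"])
    show "continuous_on UNIV (\<lambda>x. F (x + m) - F x)"
      by (intro continuous_intros continuous_on_compose2[OF cont] cont) auto
    show "F (x + m) - F x \<in> even_lattice" for x
      using F torus_of_add_lattice[OF m, of x] unfolding torus_of_eq_iff_lattice[symmetric] torus_lift_def by simp
  qed
  then show ?thesis by (intro exI[of _ "F (0 + m) - F 0"]) (metis add_diff_cancel_left' diff_add_cancel add.commute)
qed

lemma smooth_continuous:
  fixes f :: "'a::euclidean_space \<Rightarrow> 'b::real_normed_vector"
  assumes "smooth f"
  shows "continuous_on UNIV f"
  using smooth_partials_differentiable[OF assms, of "[]"]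
  by (simp add: continuous_on_eq_continuous_within differentiable_imp_continuous_within)

text \<open>A lattice translation changes \<open>F\<close> by a constant, which one differentiation
  removes. So all partial derivatives of positive order are periodic, and they are bounded by
  compactness of the square.\<close>

lemma smooth_lift_taylor2:
  assumes F: "torus_lift \<phi> F" "smooth F"
  shows "\<exists>H K. taylor2 F (gradient F) H K"
proof (rule taylor2_of_bounded_partials)
  show d: "partials vs F differentiable at x" if "set vs \<subseteq> Basis" for vs x
    by (rule smooth_partials_differentiable[OF F(2) that])
  fix vs :: "(real^2) list" assume vs: "set vs \<subseteq> Basis" "vs \<noteq> []"
  have "partials vs F (x + m) = partials vs F x" if m: "m \<in> even_lattice" for x m
    using vs
  proof (induction vs arbitrary: x)
    case (Cons v vs)
    obtain c where "\<And>x. F (x + m) = F x + c"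
      using torus_lift_shift[OF F(1) smooth_continuous[OF F(2)] m] by blast
    then have "\<exists>c. \<forall>x. partials vs F (x + m) = partials vs F x + c"
      using Cons by (cases "vs = []") (auto intro: exI[of _ 0])
    then obtain c where "\<And>x. partials vs F (x + m) = partials vs F x + c" by blast
    then have "frechet_derivative (partials vs F) (at (x + m)) = frechet_derivative (partials vs F) (at x)"
      by (intro frechet_derivative_shift d) (use Cons in auto)
    then show ?case by simp
  qed simp
  then show "\<exists>B. \<forall>x. norm (partials vs F x) \<le> B"
    using d[OF vs(1)]
    by (intro periodic_continuous_bounded)
      (auto simp: continuous_on_eq_continuous_within differentiable_imp_continuous_within)
qed

section \<open>Area preservation\<close>

definition jac_det :: "((real^2) \<Rightarrow>\<^sub>L (real^2)) \<Rightarrow> real" where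
  "jac_det A = wedge (A (axis 1 1)) (A (axis 2 1))"

lemma vec2_axis: "v = v $ 1 *\<^sub>R axis 1 1 + v $ 2 *\<^sub>R axis 2 1" for v :: "real^2"
  by (simp add: vec2_eq_iff axis_def)

lemma wedge_blinfun:
  fixes A :: "(real^2) \<Rightarrow>\<^sub>L (real^2)"
  shows "wedge (A v) (A w) = jac_det A * wedge v w"
proof -
  have A: "A v = v $ 1 *\<^sub>R A (axis 1 1) + v $ 2 *\<^sub>R A (axis 2 1)" for v
    using vec2_axis[of v] by (metis blinfun.add_right blinfun.scaleR_right)
  show ?thesis
    unfolding A[of v] A[of w] jac_det_def
    by (simp add: wedge_def algebra_simps)
qed

lemma det_eq_jac_det: "det (matrix (blinfun_apply A)) = jac_det A"
  by (simp add: det_2 matrix_def jac_det_def wedge_def algebra_simps)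

lemma jac_det_compose: "jac_det (A o\<^sub>L B) = jac_det A * jac_det B"
  using wedge_blinfun[of A] by (simp add: jac_det_def[of "A o\<^sub>L B"] jac_det_def[of B])

lemma continuous_jac_det:
  assumes "taylor2 F M H K"
  shows "continuous_on UNIV (\<lambda>x. jac_det (M x))"
proof -
  have "K-lipschitz_on UNIV M"
    using taylor2D[OF assms] by (intro lipschitz_onI) (auto simp: dist_norm norm_minus_commute)
  then have "continuous_on UNIV M" by (rule lipschitz_on_continuous_on)
  then show ?thesis
    unfolding jac_det_def by (intro wedge.continuous_on blinfun.continuous_on continuous_on_const)
qed

lemma lattice_uminus: "m \<in> even_lattice \<Longrightarrow> - m \<in> even_lattice"
  unfolding even_lattice_def by (auto) (metis minus_mult_right of_int_minus)

section \<open>Topology and measure of the torus\<close>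

lemma vimage_torus_of_image: "torus_of -` torus_of ` S = (\<Union>m\<in>even_lattice. (+) m ` S)"
proof (intro set_eqI iffI)
  fix x assume "x \<in> torus_of -` torus_of ` S"
  then obtain y where y: "y \<in> S" "x - y \<in> even_lattice" by (auto simp: torus_of_eq_iff_lattice)
  then have "x = (x - y) + y" by simp
  then show "x \<in> (\<Union>m\<in>even_lattice. (+) m ` S)" using y by blast
next
  fix x assume "x \<in> (\<Union>m\<in>even_lattice. (+) m ` S)"
  then obtain m y where "m \<in> even_lattice" "y \<in> S" "x = y + m" by (auto simp: add.commute)
  then show "x \<in> torus_of -` torus_of ` S" by (simp add: torus_of_add_lattice)
qed

lemma open_torus_iff: "open B \<longleftrightarrow> open (torus_of -` B)"
  by (simp add: open_torus_def)

lemma open_torus_of_image: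
  assumes "open S"
  shows "open (torus_of ` S)"
  unfolding open_torus_iff vimage_torus_of_image by (intro open_UN ballI open_translation assms)

lemma continuous_torus_of: "continuous_on UNIV torus_of"
  by (simp add: continuous_on_open_vimage open_torus_iff)

lemma continuous_if_lift:
  assumes F: "torus_lift \<phi> F" "continuous_on UNIV F"
  shows "continuous_on UNIV \<phi>"
proof -
  have "open (\<phi> -` B)" if "open B" for B
  proof -
    have "torus_of -` (\<phi> -` B) = F -` (torus_of -` B)"
      using F(1) by (auto simp: torus_lift_def)
    then show ?thesis
      using that F(2) unfolding open_torus_iff by (simp add: open_vimage)
  qed
  then show ?thesis by (simp add: continuous_on_open_vimage)
qed

lemma sets_torus_measure [simp]: "sets torus_measure = sets borel"
  by (simp add: torus_measure_def)

lemma space_torus_measure [simp]: "space torus_measure = UNIV"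
  by (simp add: torus_measure_def)

text \<open>A point of the closed square and one of the open square that differ by a lattice vector
  coincide, because their coordinates differ by less than 2. So the preimage of the projected set
  meets the square in just the translate of \<open>S\<close>.\<close>

lemma torus_measure_image:
  assumes S: "open S" and m: "m \<in> even_lattice" and sub: "(+) m ` S \<subseteq> box (- 1) 1"
  shows "measure torus_measure (torus_of ` S) = measure lebesgue S"
proof -
  define S' where "S' = (+) m ` S"
  have S': "open S'" unfolding S'_def by (intro open_translation S)
  have "torus_of ` S = torus_of ` S'"
    unfolding S'_def image_image using torus_of_add_lattice[OF m] by (simp add: add.commute)
  then have "measure torus_measure (torus_of ` S) = measure torus_measure (torus_of ` S')" by simp
  also have "\<dots> = measure (restrict_space lborel (cbox (- 1) 1)) (torus_of -` torus_of ` S' \<inter> cbox (- 1) 1)"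
  proof -
    have "torus_of \<in> measurable (restrict_space lborel (cbox (- 1) 1)) borel"
      by (intro measurable_restrict_space1) (simp add: borel_measurable_continuous_onI continuous_torus_of)
    moreover have "torus_of ` S' \<in> sets borel" by (intro borel_open open_torus_of_image S')
    ultimately show ?thesis
      unfolding torus_measure_def by (simp add: measure_distr)
  qed
  also have "torus_of -` torus_of ` S' \<inter> cbox (- 1) 1 = S'"
  proof (intro equalityI subsetI)
    fix x assume x: "x \<in> torus_of -` torus_of ` S' \<inter> cbox (- 1) 1"
    then obtain y where y: "y \<in> S'" "x - y \<in> even_lattice" by (auto simp: torus_of_eq_iff_lattice)
    have yb: "y \<in> box (- 1) 1" using y sub by (auto simp: S'_def)
    have "x $ i = y $ i" for i
    proof -
      obtain k :: int where k: "x $ i - y $ i = 2 * of_int k"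
        using y(2) unfolding even_lattice_def by (auto simp del: of_int_mult)
      have "- 1 < y $ i" "y $ i < 1" using yb by (auto simp: mem_box_cart)
      moreover have "- 1 \<le> x $ i" "x $ i \<le> 1" using x by (auto simp: mem_box_cart)
      ultimately have "\<bar>2 * real_of_int k\<bar> < 2" using k by linarith
      then have "k = 0" by linarith
      then show ?thesis using k by simp
    qed
    then have "x = y" by (simp add: vec_eq_iff)
    then show "x \<in> S'" using y by simp
  next
    fix x assume "x \<in> S'"
    then show "x \<in> torus_of -` torus_of ` S' \<inter> cbox (- 1) 1"
      using sub box_subset_cbox by (fastforce simp: S'_def)
  qed
  also have "measure (restrict_space lborel (cbox (- 1) 1)) S' = measure lborel S'"
    using sub box_subset_cbox by (intro measure_restrict_space) (auto simp: S'_def)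
  also have "\<dots> = measure lebesgue S'" using S' by (simp add: measure_completion)
  also have "\<dots> = measure lebesgue S" unfolding S'_def by (rule measure_translation)
  finally show ?thesis .
qed

text \<open>A short diagonal shift of a point of \<open>W\<close> that stops before the next integer
  in either coordinate works; \<open>e / 4\<close> keeps it inside the ball, as its norm is at most
  \<open>2 * t\<close>.\<close>

lemma non_integral_dense:
  fixes W :: "(real^2) set"
  assumes "open W" "W \<noteq> {}"
  shows "\<exists>x\<in>W. \<forall>i. x $ i \<notin> \<int>"
proof -
  obtain x e where x: "x \<in> W" "0 < e" "ball x e \<subseteq> W" using assms open_contains_ball by blast
  define t where "t = min (e / 4) (min ((of_int \<lfloor>x $ 1\<rfloor> + 1 - x $ 1) / 2) ((of_int \<lfloor>x $ 2\<rfloor> + 1 - x $ 2) / 2))"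
  have pos: "0 < of_int \<lfloor>x $ i\<rfloor> + 1 - x $ i" for i by linarith
  have t: "0 < t" "t \<le> e / 4" using x(2) pos[of 1] pos[of 2] by (auto simp: t_def)
  have ti: "t < of_int \<lfloor>x $ i\<rfloor> + 1 - x $ i" for i
  proof -
    have "t \<le> (of_int \<lfloor>x $ 1\<rfloor> + 1 - x $ 1) / 2"
      unfolding t_def by (rule min.coboundedI2, rule min.cobounded1)
    moreover have "t \<le> (of_int \<lfloor>x $ 2\<rfloor> + 1 - x $ 2) / 2"
      unfolding t_def by (rule min.coboundedI2, rule min.cobounded2)
    ultimately have "t \<le> (of_int \<lfloor>x $ i\<rfloor> + 1 - x $ i) / 2"
      using exhaust_2[of i] by (elim disjE) simp_all
    moreover have "d / 2 < d" if "0 < d" for d :: real using that by simp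
    ultimately show ?thesis using pos[of i] order.strict_trans1 by blast
  qed
  define y :: "real^2" where "y = x + (\<chi> i. t)"
  have "norm (y - x) \<le> (\<Sum>i\<in>UNIV. \<bar>(y - x) $ i\<bar>)" by (rule norm_le_l1_cart)
  also have "\<dots> = 2 * t" using t by (simp add: y_def sum_2)
  also have "\<dots> < e" using t x(2) by linarith
  finally have "y \<in> W" using x(3) by (auto simp: dist_norm norm_minus_commute)
  moreover have "y $ i \<notin> \<int>" for i
  proof
    assume "y $ i \<in> \<int>"
    then obtain k :: int where k: "y $ i = of_int k" using Ints_cases by blast
    then have "x $ i + t = of_int k" by (simp add: y_def)
    then have "of_int \<lfloor>x $ i\<rfloor> < real_of_int k" "real_of_int k < of_int \<lfloor>x $ i\<rfloor> + 1"
      using ti[of i] t(1) of_int_floor_le[of "x $ i"] by linarith+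
    moreover have False if "of_int l < real_of_int k" "real_of_int k < of_int l + 1" for l
      using that of_int_less_iff[of k "l + 1", where 'a = real] by simp
    ultimately show False by blast
  qed
  ultimately show ?thesis by blast
qed

lemma lattice_reduction_interior:
  assumes "\<forall>i. x $ i \<notin> \<int>"
  shows "\<exists>m\<in>even_lattice. m + x \<in> box (- 1) 1"
proof -
  obtain m where m: "m \<in> even_lattice" "x + m \<in> cbox (- 1) 1" using lattice_reduction by blast
  have "m + x \<in> box (- 1) 1"
    unfolding mem_box_cart
  proof
    fix i
    obtain k :: int where k: "m $ i = 2 * of_int k" using m(1) unfolding even_lattice_def by blast
    have "(x + m) $ i \<notin> \<int>"
    proof
      assume "(x + m) $ i \<in> \<int>"
      then have "(x + m) $ i - m $ i \<in> \<int>" unfolding k by (intro Ints_diff Ints_mult) auto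
      then show False using assms by simp
    qed
    then have "(x + m) $ i \<noteq> - 1" "(x + m) $ i \<noteq> 1" by (metis Ints_1 Ints_minus)+
    moreover have "- 1 \<le> (x + m) $ i" "(x + m) $ i \<le> 1" using m(2) by (auto simp: mem_box_cart)
    ultimately show "(- 1) $ i < (m + x) $ i \<and> (m + x) $ i < 1 $ i" by (auto simp: add.commute)
  qed
  then show ?thesis using m(1) by blast
qed

text \<open>Otherwise \<open>F\<close> shrinks the area of a small box. The box is chosen such that neither it nor its
  image meets the edges of the square modulo the lattice.\<close>

lemma jac_det_ge_1_if_volume_preserving:
  assumes lift: "torus_lift \<phi> F" and bij: "bij \<phi>" and vol: "volume_preserving \<phi>"
    and F: "taylor2 F M H K" and G: "continuous_on UNIV G" "\<And>x. G (F x) = x" "\<And>x. F (G x) = x"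
  shows "1 \<le> \<bar>jac_det (M x\<^sub>0)\<bar>"
proof (rule ccontr)
  assume "\<not> 1 \<le> \<bar>jac_det (M x\<^sub>0)\<bar>"
  then obtain B where B: "\<bar>jac_det (M x\<^sub>0)\<bar> < B" "B < 1" using dense[of "\<bar>jac_det (M x\<^sub>0)\<bar>" 1] by auto
  have contJ: "continuous_on UNIV (\<lambda>x. \<bar>jac_det (M x)\<bar>)"
    by (intro continuous_intros continuous_jac_det[OF F])
  have Fd: "(F has_derivative M x) (at x)" for x by (rule taylor2_has_derivative[OF F])
  have contF: "continuous_on UNIV F"
    using Fd by (intro has_derivative_continuous_on) simp
  \<comment> \<open>Openness of images comes from the continuous inverse.\<close>
  have image_eq: "F ` S = G -` S" for S
    by (auto simp: G(2) intro: image_eqI[where f = F, OF G(3)[symmetric]])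
  have open_image: "open (F ` S)" if "open S" for S
    unfolding image_eq using that G(1) by (simp add: open_vimage)
  define W where "W = {x. \<bar>jac_det (M x)\<bar> < B}"
  have W: "open W" "x\<^sub>0 \<in> W"
    unfolding W_def using B contJ by (auto intro: open_Collect_less continuous_on_const)
  define Q where "Q = {x :: real^2. \<forall>i. x $ i \<notin> \<int>}"
  have Q: "open Q"
  proof -
    have "Q = (\<Inter>i. (\<lambda>x. x $ i) -` (- \<int>))" by (auto simp: Q_def)
    moreover have "open ((\<lambda>x::real^2. x $ i) -` (- \<int>))" for i
      by (intro open_vimage open_Compl closed_Ints continuous_on_component continuous_on_id)
    ultimately show ?thesis by (simp add: open_INT)
  qed
  \<comment> \<open>Density is used twice, in \<open>W\<close> and in the image of
    \<open>W \<inter> Q\<close>, so that both \<open>x\<close> and \<open>F x\<close> have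
    non-integral coordinates.\<close>
  have "W \<inter> Q \<noteq> {}" using non_integral_dense[OF W(1)] W(2) by (auto simp: Q_def)
  then obtain y where "y \<in> F ` (W \<inter> Q)" "\<forall>i. y $ i \<notin> \<int>"
    using non_integral_dense[OF open_image[of "W \<inter> Q"]] W(1) Q by auto
  then obtain x where x: "x \<in> W" "\<forall>i. x $ i \<notin> \<int>" "\<forall>i. F x $ i \<notin> \<int>" by (auto simp: Q_def)
  obtain m where m: "m \<in> even_lattice" "m + x \<in> box (- 1) 1" using lattice_reduction_interior[OF x(2)] by blast
  obtain c where c: "c \<in> even_lattice" "c + F x \<in> box (- 1) 1" using lattice_reduction_interior[OF x(3)] by blast
  define V where "V = W \<inter> (\<lambda>z. m + z) -` box (- 1) 1 \<inter> (\<lambda>z. c + F z) -` box (- 1) 1"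
  have "open V" unfolding V_def
    by (intro open_Int W open_vimage open_box continuous_on_add continuous_on_const continuous_on_id contF)
  moreover have "x \<in> V" using x m c by (simp add: V_def)
  ultimately obtain a b where ab: "cbox a b \<subseteq> V" "x \<in> box a b" "\<forall>i\<in>Basis. a \<bullet> i < b \<bullet> i"
    using open_contains_cbox by metis
  define S where "S = box a b"
  have S: "open S" "S \<subseteq> V" using ab box_subset_cbox[of a b] by (auto simp: S_def)
  have "measure lebesgue (F ` S) \<le> B * measure lebesgue S"
  proof (rule measure_bounded_differentiable_image)
    show "S \<in> lmeasurable" by (simp add: S_def)
    show "(F has_derivative M x) (at x within S)" for x using Fd by (rule has_derivative_at_withinI)
    show "(\<lambda>x. \<bar>det (matrix (blinfun_apply (M x)))\<bar>) integrable_on S"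
      unfolding S_def integrable_on_open_interval det_eq_jac_det
      by (intro integrable_continuous continuous_on_subset[OF contJ]) simp
    show "\<bar>det (matrix (blinfun_apply (M x)))\<bar> \<le> B" if "x \<in> S" for x
      using that S(2) by (auto simp: det_eq_jac_det V_def W_def)
  qed
  \<comment> \<open>\<open>S\<close> and its image both have lattice translates in the open square,
    so their areas are torus measures, and these agree by volume preservation.\<close>
  moreover have "measure lebesgue S = measure lebesgue (F ` S)"
  proof -
    have FS: "open (F ` S)" by (rule open_image[OF S(1)])
    have img: "torus_of ` F ` S = \<phi> ` torus_of ` S"
      unfolding image_image using lift by (simp add: torus_lift_def)
    have "continuous_on UNIV \<phi>" by (rule continuous_if_lift[OF lift contF])
    then have meas: "\<phi> \<in> measurable torus_measure torus_measure"
      by (simp add: borel_measurable_continuous_onI cong: measurable_cong_sets)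
    have "measure lebesgue (F ` S) = measure torus_measure (torus_of ` F ` S)"
      using S(2) by (intro torus_measure_image[OF FS c(1), symmetric]) (auto simp: V_def)
    also have "\<dots> = measure (distr torus_measure torus_measure \<phi>) (torus_of ` F ` S)"
      using vol by (simp add: volume_preserving_def)
    also have "\<dots> = measure torus_measure (\<phi> -` (torus_of ` F ` S))"
      using FS by (subst measure_distr[OF meas]) (auto intro: borel_open open_torus_of_image)
    also have "\<phi> -` (torus_of ` F ` S) = torus_of ` S"
      unfolding img using bij by (simp add: bij_is_inj inj_vimage_image_eq)
    also have "measure torus_measure (torus_of ` S) = measure lebesgue S"
      using S(2) by (intro torus_measure_image[OF S(1) m(1)]) (auto simp: V_def)
    finally show ?thesis by simp
  qed
  moreover have "0 < measure lebesgue S"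
    using ab(3) by (simp add: S_def measure_lborel_box_eq measure_completion less_imp_le prod_pos inner_diff_left)
  ultimately show False using B(2) by (simp add: mult_le_cancel_right1)
qed

lemma volume_preserving_inv:
  assumes "volume_preserving \<phi>" "bij \<phi>" "continuous_on UNIV \<phi>" "continuous_on UNIV (inv \<phi>)"
  shows "volume_preserving (inv \<phi>)"
proof -
  have meas: "\<psi> \<in> measurable torus_measure torus_measure" if "continuous_on UNIV \<psi>" for \<psi>
    using that by (simp add: borel_measurable_continuous_onI cong: measurable_cong_sets)
  have "distr torus_measure torus_measure (inv \<phi>)
      = distr (distr torus_measure torus_measure \<phi>) torus_measure (inv \<phi>)"
    using assms(1) by (simp add: volume_preserving_def)
  also have "\<dots> = distr torus_measure torus_measure (inv \<phi> \<circ> \<phi>)"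
    by (intro distr_distr meas assms)
  also have "\<dots> = torus_measure"
    using assms(2) by (simp add: bij_is_inj distr_id[unfolded id_def[symmetric]] id_def)
  finally show ?thesis by (simp add: volume_preserving_def)
qed

section \<open>Invariant line fields on the torus\<close>

text \<open>An arbitrary lift of the inverse undoes \<open>F\<close> only up to a lattice vector,
  which is constant by continuity; subtracting it gives the true inverse.\<close>

lemma torus_diffeo_inverse_lifts:
  assumes "torus_diffeo \<phi>"
  obtains F G M H K MG HG KG where
    "torus_lift \<phi> F" "torus_lift (inv \<phi>) G" "taylor2 F M H K" "taylor2 G MG HG KG"
    "\<And>x. G (F x) = x" "\<And>x. F (G x) = x"
proof -
  obtain F G\<^sub>0 where F: "smooth F" "torus_lift \<phi> F" and G\<^sub>0: "smooth G\<^sub>0" "torus_lift (inv \<phi>) G\<^sub>0"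
    and bij: "bij \<phi>"
    using assms unfolding torus_diffeo_def by blast
  obtain H K where tF: "taylor2 F (gradient F) H K" using smooth_lift_taylor2[OF F(2,1)] by blast
  obtain HG KG where tG\<^sub>0: "taylor2 G\<^sub>0 (gradient G\<^sub>0) HG KG" using smooth_lift_taylor2[OF G\<^sub>0(2,1)] by blast
  note cont = smooth_continuous[OF F(1)] smooth_continuous[OF G\<^sub>0(1)]
  define c where "c = G\<^sub>0 (F 0) - 0"
  define G where "G x = G\<^sub>0 x - c" for x
  have lat: "G\<^sub>0 (F x) - x \<in> even_lattice" for x
    using F(2) G\<^sub>0(2) bij unfolding torus_of_eq_iff_lattice[symmetric] torus_lift_def
    by (simp add: bij_is_inj)
  have "G\<^sub>0 (F x) - x = c" for x
    unfolding c_def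
    by (rule continuous_lattice_valued_constant[where h = "\<lambda>x. G\<^sub>0 (F x) - x"])
       (auto intro!: continuous_intros continuous_on_compose2[OF cont(2)] cont lat)
  then have GF: "G (F x) = x" for x unfolding G_def by (metis diff_diff_eq2 add_diff_cancel_left')
  have "c \<in> even_lattice" using lat[of 0] by (simp add: c_def)
  then have tGx: "torus_of (G x) = torus_of (G\<^sub>0 x)" for x
    unfolding torus_of_eq_iff_lattice by (simp add: G_def lattice_uminus)
  have G: "torus_lift (inv \<phi>) G" using G\<^sub>0(2) by (simp add: torus_lift_def tGx)
  have latF: "F (G x) - x \<in> even_lattice" for x
    using F(2) G bij unfolding torus_of_eq_iff_lattice[symmetric] torus_lift_def
    by (simp add: bij_is_surj surj_f_inv_f)
  \<comment> \<open>The constant is evaluated at \<open>F 0\<close>, where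
    \<open>G (F 0) = 0\<close> makes it vanish.\<close>
  have "F (G x) - x = F (G (F 0)) - F 0" for x
    unfolding G_def
    by (rule continuous_lattice_valued_constant[where h = "\<lambda>x. F (G\<^sub>0 x - c) - x"])
       (auto intro!: continuous_intros continuous_on_compose2[OF cont(1)] cont latF[unfolded G_def])
  then have FG: "F (G x) = x" for x unfolding GF by simp
  have "taylor2 G (gradient G\<^sub>0) HG KG" using tG\<^sub>0 by (simp add: taylor2_def G_def)
  then show ?thesis using that F(2) G tF GF FG by blast
qed

lemma jac_det_inverse:
  assumes "taylor2 F M H K" "taylor2 G MG HG KG" "\<And>x. G (F x) = x"
  shows "jac_det (MG (F x)) * jac_det (M x) = 1"
proof -
  have "MG (F x) (M x v) = v" for v
    using iterate_deriv_inverse[OF assms, of 1 x v] by simp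
  then have "MG (F x) o\<^sub>L M x = id_blinfun" by (intro blinfun_eqI) simp
  then have "jac_det (MG (F x)) * jac_det (M x) = jac_det id_blinfun"
    by (simp add: jac_det_compose[symmetric])
  then show ?thesis by (simp add: jac_det_def wedge_def axis_def)
qed

lemma torus_lift_funpow:
  assumes "torus_lift \<phi> F"
  shows "torus_lift (\<phi> ^^ n) (F ^^ n)"
  using assms by (induction n) (auto simp: torus_lift_def)

text \<open>A choice point by point: a non-orientable line field has no continuous global unit
  section.\<close>

lemma unit_generator:
  assumes "line_subbundle E"
  shows "\<exists>w. \<forall>p. norm (w p) = 1 \<and> E p = span {w p}"
proof (rule choice, rule allI)
  fix p
  obtain X where X: "X \<noteq> 0" "E p = span {X}"
    using assms unfolding line_subbundle_def by (metis imageE)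
  have "span {(1 / norm X) *\<^sub>R X} = span {X}"
    using span_image_scale[of "{X}" "\<lambda>_. 1 / norm X"] X(1) by simp
  then show "\<exists>w. norm w = 1 \<and> E p = span {w}"
    using X by (intro exI[of _ "(1 / norm X) *\<^sub>R X"]) simp
qed

text \<open>\<open>\<psi>\<close> is a variable of its own rather than \<open>inv \<phi>\<close>, so
  that the stable case arises by exchanging the two maps, their lifts and the two line
  fields.\<close>

lemma invariant_line_field_holder_torus:
  assumes lift: "torus_lift \<phi> F" "torus_lift \<psi> G"
    and t: "taylor2 F M H K" "taylor2 G MG HG KG"
    and inverse: "\<And>x. G (F x) = x" "\<And>x. F (G x) = x"
    and jac: "\<And>x. \<bar>jac_det (M x)\<bar> = 1"
    and E: "line_subbundle E" "line_subbundle E'"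
    and invariant: "\<And>p. torus_deriv \<phi> p ` E p \<subseteq> E (\<phi> p)"
    and C: "0 < C" and \<mu>: "0 < \<mu>" "\<mu> < 1"
    and contract: "\<And>p w n. w \<in> E p \<Longrightarrow> norm (torus_deriv (\<psi> ^^ n) p w) \<le> C * \<mu> ^ n * norm w"
      "\<And>p w n. w \<in> E' p \<Longrightarrow> norm (torus_deriv (\<phi> ^^ n) p w) \<le> C * \<mu> ^ n * norm w"
    and b: "b < 2"
  shows "holder_line_field b E"
proof -
  obtain w w' where "\<And>p. norm (w p) = 1 \<and> E p = span {w p}" "\<And>p. norm (w' p) = 1 \<and> E' p = span {w' p}"
    using unit_generator[OF E(1)] unit_generator[OF E(2)] by blast
  moreover define u s where "u x = w (torus_of x)" and "s x = w' (torus_of x)" for x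
  ultimately have u: "\<And>x. norm (u x) = 1" "\<And>x. E (torus_of x) = span {u x}"
    and s: "\<And>x. norm (s x) = 1" "\<And>x. E' (torus_of x) = span {s x}"
    by simp_all
  have deriv: "torus_deriv (\<phi> ^^ n) (torus_of x) = iterate_deriv F M n x"
    "torus_deriv (\<psi> ^^ n) (torus_of x) = iterate_deriv G MG n x" for n x
    using lift t by (auto intro!: torus_deriv_eq torus_lift_funpow iterate_has_derivative)
  interpret area_preserving_hyperbolic F G M MG H HG K KG C \<mu> u s "\<lambda>x. jac_det (M x)"
  proof
    fix x
    have "M x (u x) \<in> torus_deriv \<phi> (torus_of x) ` E (torus_of x)"
      using deriv(1)[of 1 x] span_base[of "u x" "{u x}"] by (auto simp: u(2))
    also have "\<dots> \<subseteq> E (\<phi> (torus_of x))" by (rule invariant)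
    also have "\<phi> (torus_of x) = torus_of (F x)" using lift(1) by (simp add: torus_lift_def)
    finally show "\<exists>c. M x (u x) = c *\<^sub>R u (F x)" by (auto simp: u(2) span_singleton)
    show "norm (iterate_deriv G MG n x (u x)) \<le> C * \<mu> ^ n" for n
      using contract(1)[of "u x" "torus_of x" n] by (simp add: deriv u span_base)
    show "norm (iterate_deriv F M n x (s x)) \<le> C * \<mu> ^ n" for n
      using contract(2)[of "s x" "torus_of x" n] by (simp add: deriv s span_base)
  qed (use t inverse jac u s C \<mu> in \<open>auto simp: wedge_blinfun\<close>)
  show ?thesis
    unfolding holder_line_field_def
  proof
    fix p
    obtain x0 where x0: "torus_of x0 = p" using torus_of_surj by blast
    obtain r X where r: "0 < r" and X: "\<forall>i. holder_on b (\<lambda>x. X x $ i) (ball x0 r)"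
        "\<forall>x\<in>ball x0 r. X x \<noteq> 0 \<and> span {X x} = span {u x}"
      using invariant_line_field_holder[OF b] by blast
    then show "\<exists>U X. open U \<and> p \<in> torus_of ` U \<and> (\<forall>i. holder_on b (\<lambda>x. X x $ i) U) \<and>
        (\<forall>x\<in>U. X x \<noteq> 0 \<and> E (torus_of x) = span {X x})"
      using x0 by (intro exI[of _ "ball x0 r"] exI[of _ X]) (auto simp: u(2))
  qed
qed

theorem theorem1p1:
  fixes \<alpha> \<epsilon> :: real
    and \<phi> :: "torus \<Rightarrow> torus"
    and Eu Es :: "torus \<Rightarrow> (real^2) set"
  assumes "0 < \<alpha>" and "\<alpha> \<le> 2" and "\<epsilon> > 0"
    and "anosov \<phi> Eu Es"
    and "bunched \<alpha> \<phi> Eu Es"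
  shows "holder_line_field (\<alpha> - \<epsilon>) Eu \<and> holder_line_field (\<alpha> - \<epsilon>) Es"
proof -
  have diffeo: "torus_diffeo \<phi>" and vol: "volume_preserving \<phi>"
    and E: "line_subbundle Eu" "line_subbundle Es"
    and invariant: "\<And>p. torus_deriv \<phi> p ` Eu p = Eu (\<phi> p)" "\<And>p. torus_deriv \<phi> p ` Es p = Es (\<phi> p)"
    using assms(4) unfolding anosov_def by auto
  obtain C \<kappa> \<mu> where C: "0 < C" and \<mu>: "0 < \<mu>" "\<mu> < 1" and bounds: "\<And>p. contraction_bounds \<phi> Eu Es C \<kappa> \<mu> p"
    using assms(4) unfolding anosov_def by (meson less_trans)
  \<comment> \<open>\<open>contraction_bounds\<close> quantifies over both vectors at once; the zero
    vector of one line isolates the bounds for the other.\<close>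
  have zero: "0 \<in> Eu p" "0 \<in> Es p" for p
    using unit_generator[OF E(1)] unit_generator[OF E(2)] span_zero by metis+
  have contract: "w \<in> Eu p \<Longrightarrow> norm (torus_deriv (inv \<phi> ^^ n) p w) \<le> C * \<mu> ^ n * norm w"
    "w \<in> Es p \<Longrightarrow> norm (torus_deriv (\<phi> ^^ n) p w) \<le> C * \<mu> ^ n * norm w" for w p n
    using bounds[of p] zero[of p] unfolding contraction_bounds_def by blast+
  have bij: "bij \<phi>" using diffeo by (simp add: torus_diffeo_def)
  obtain F G M H K MG HG KG where lift: "torus_lift \<phi> F" "torus_lift (inv \<phi>) G"
    and t: "taylor2 F M H K" "taylor2 G MG HG KG"
    and inverse: "\<And>x. G (F x) = x" "\<And>x. F (G x) = x"
    using torus_diffeo_inverse_lifts[OF diffeo] by metis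
  have cont: "continuous_on UNIV F" "continuous_on UNIV G"
    using taylor2_has_derivative[OF t(1)] taylor2_has_derivative[OF t(2)]
    by (auto intro!: has_derivative_continuous_on)
  have vol': "volume_preserving (inv \<phi>)"
    by (intro volume_preserving_inv vol bij continuous_if_lift[OF lift(1) cont(1)] continuous_if_lift[OF lift(2) cont(2)])
  have ge1: "1 \<le> \<bar>jac_det (M x)\<bar>" "1 \<le> \<bar>jac_det (MG x)\<bar>" for x
    using jac_det_ge_1_if_volume_preserving[OF lift(1) bij vol t(1) cont(2) inverse]
      jac_det_ge_1_if_volume_preserving[OF lift(2) bij_imp_bij_inv[OF bij] vol' t(2) cont(1) inverse(2,1)]
    by auto
  \<comment> \<open>Area comparison yields only lower bounds, but for both lifts; the two Jacobians
    multiply to 1, so equality holds.\<close>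
  have jac: "\<bar>jac_det (M x)\<bar> = 1" "\<bar>jac_det (MG x)\<bar> = 1" for x
  proof -
    have eq: "\<bar>jac_det (MG (F y))\<bar> * \<bar>jac_det (M y)\<bar> = 1" for y
      using jac_det_inverse[OF t inverse(1), of y] by (simp add: abs_mult[symmetric])
    have "a = 1 \<and> b = 1" if "a * b = 1" "1 \<le> a" "1 \<le> b" for a b :: real
      using that mult_mono[of 1 a b b] mult_mono[of a a 1 b] by auto
    from this[OF eq ge1(2,1)] show "\<bar>jac_det (M x)\<bar> = 1" "\<bar>jac_det (MG x)\<bar> = 1"
      using inverse(2)[of x] by metis+
  qed
  have b: "\<alpha> - \<epsilon> < 2" using assms by simp
  have "holder_line_field (\<alpha> - \<epsilon>) Eu"
    by (rule invariant_line_field_holder_torus[OF lift t inverse jac(1) E _ C \<mu> contract b])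
       (simp_all add: invariant)
  \<comment> \<open>Here the inverse is the expanding map. Its invariance of \<open>Es\<close>
    follows by applying the inverse derivative to the equality for \<open>\<phi>\<close> at
    \<open>inv \<phi> p\<close>.\<close>
  moreover have "holder_line_field (\<alpha> - \<epsilon>) Es"
  proof (rule invariant_line_field_holder_torus[OF lift(2,1) t(2,1) inverse(2,1) jac(2) E(2,1) _ C \<mu> contract(2,1) b])
    fix p
    obtain y where y: "torus_of y = p" using torus_of_surj by blast
    define x where "x = G y"
    have Fx: "F x = y" "torus_of x = inv \<phi> p" "\<phi> (inv \<phi> p) = p"
      using lift(2) y bij by (auto simp: x_def inverse torus_lift_def bij_is_surj surj_f_inv_f)
    have d: "torus_deriv \<phi> (inv \<phi> p) = M x" "torus_deriv (inv \<phi>) p = MG (F x)"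
      using torus_deriv_eq[OF lift(1) taylor2_has_derivative[OF t(1), of x]]
        torus_deriv_eq[OF lift(2) taylor2_has_derivative[OF t(2), of y]] by (simp_all add: Fx y)
    have "MG (F x) (M x w) = w" for w
      using iterate_deriv_inverse[OF t inverse(1), of 1 x w] by simp
    moreover have "Es p = M x ` Es (inv \<phi> p)"
      using invariant(2)[of "inv \<phi> p"] unfolding d Fx(3) by simp
    ultimately show "torus_deriv (inv \<phi>) p ` Es p \<subseteq> Es (inv \<phi> p)"
      unfolding d by auto
  qed auto
  ultimately show ?thesis ..
qed

end
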